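(* Let $G = (V,E)$ be a compact topological packing graph with $V \neq \emptyset$, and let $\alpha(G)$ denote its independence number. For an integer $k \ge 2$ let $\Delta_k(G)$ be the $k$-point bound, and for an integer $r \ge 0$ let $\xi_r(G)$ be the optimal value of the (primal) copositive-hierarchy problem, both as defined in the context. Then for every integer $r \ge 1$ we have $\Delta_{r+2}(G) \le \xi_r(G)$, and $\Delta_k(G) = \alpha(G)$ for all integers $k \ge \alpha(G) + 2$.
   Context: **Graphs.** Graphs are simple and undirected. A topological graph is a graph $G=(V,E)$ whose vertex set $V$ is a Hausdorff topological space; it is compact if $V$ is compact. It is a packing graph if every finite clique is contained in an open clique (a clique is a set of pairwise adjacent vertices; an open clique is a clique that is an open subset of $V$). The edge set $E$ is also regarded as the symmetric subset $\{(x,y): x,y \text{ adjacent}\}$ of $V^2$; for a packing graph it is open. The independence number $\alpha(G)$ is the maximum cardinality of an independent set (set of pairwise nonadjacent vertices); the empty set is independent. **Function and measure spaces.** For a topological space $X$, $C(X)$ is the space of real-valued continuous functions on $X$, and $M(X)$ is the space of signed Radon measures on $X$ of bounded total variation, with duality $\langle f,\mu\rangle=\int_X f\,d\mu$. $M(X)_{\ge 0}$ is the cone of nonnegative measures in $M(X)$. $C_{\rm sym}(X)$ is the space of symmetric continuous kernels $F\colon X^2\to\mathbb{R}$, and $M_{\rm sym}(X)$ is the space of $\mu\in M(X^2)$ that are invariant under swapping the two coordinates; $M_{\rm sym}(X)_{\ge 0}$ is its subset of nonnegative measures. Adjoints and dual cones are taken with respect to this duality and denoted by an asterisk. **Spaces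 of subsets.** For a set $A$ and an integer $k\ge 0$, $\mathrm{Sub}(A,k)$ is the collection of all subsets of $A$ of cardinality at most $k$. For $k\ge1$, $\mathrm{Sub}(V,k)\setminus\{\emptyset\}$ carries the quotient topology of the map $V^k\to \mathrm{Sub}(V,k)\setminus\{\emptyset\}$, $(v_1,\dots,v_k)\mapsto\{v_1,\dots,v_k\}$, and $\mathrm{Sub}(V,k)$ is the disjoint union of this space with the one-point space $\{\emptyset\}$ (for $k=0$ it is just the one-point space $\{\emptyset\}$). $\mathcal{I}_k\subseteq\mathrm{Sub}(V,k)$ is the collection of independent sets of $G$ of cardinality at most $k$ (including $\emptyset$), with the relative topology, and $\mathcal{I}_{=k}$ is the collection of independent sets of cardinality exactly $k$. **The $k$-point bound.** Let $k\ge 2$. $C_{\rm sym}(\mathcal{I}_1^2\times\mathcal{I}_{k-2})$ is the space of continuous $F\colon\mathcal{I}_1^2\times\mathcal{I}_{k-2}\to\mathbb{R}$ with $F(S,T,Q)=F(T,S,Q)$ for all $(S,T,Q)$; $M_{\rm sym}(\mathcal{I}_1^2\times\mathcal{I}_{k-2})$ is the space of signed Radon measures on $\mathcal{I}_1^2\times\mathcal{I}_{k-2}$ of bounded total variation that are invariant under $(S,T,Q)\mapsto(T,S,Q)$. The linear map $B_k\colon C_{\rm sym}(\mathcal{I}_1^2\times\mathcal{I}_{k-2})\to C(\mathcal{I}_k)$ is $$(B_kF)(I)=\sum_{Q\in\mathrm{Sub}(V,k-2)}\ \sum_{\substack{S,T\in\mathrm{Sub}(I,1)\\ Q\cup S\cup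 T=I}}F(S,T,Q)\qquad(I\in\mathcal{I}_k)$$ (only $Q\subseteq I$ contribute, so the sum is finite); it is well defined and continuous for packing graphs, and $B_k^*\colon M(\mathcal{I}_k)\to M_{\rm sym}(\mathcal{I}_1^2\times\mathcal{I}_{k-2})$ is its adjoint, $\langle F,B_k^*\nu\rangle=\langle B_kF,\nu\rangle$. $C(\mathcal{I}_1^2\times\mathcal{I}_{k-2})_{\succeq0}$ is the cone of $F\in C_{\rm sym}(\mathcal{I}_1^2\times\mathcal{I}_{k-2})$ such that the kernel $(S,T)\mapsto F(S,T,Q)$ is positive semidefinite for every $Q$, and $M(\mathcal{I}_1^2\times\mathcal{I}_{k-2})_{\succeq0}$ is its dual cone, i.e. the set of $\mu\in M_{\rm sym}(\mathcal{I}_1^2\times\mathcal{I}_{k-2})$ with $\langle F,\mu\rangle\ge0$ for all $F\in C(\mathcal{I}_1^2\times\mathcal{I}_{k-2})_{\succeq0}$. Then $$\Delta_k(G)=\sup\{\nu(\mathcal{I}_{=1}) : \nu\in M(\mathcal{I}_k)_{\ge0},\ \nu(\{\emptyset\})=1,\ B_k^*\nu\in M(\mathcal{I}_1^2\times\mathcal{I}_{k-2})_{\succeq0}\}.$$ **The copositive hierarchy.** For $r\ge0$ let $\mathcal{T}_r\colon C(V^2)\to C(V^{r+2})$ be $$(\mathcal{T}_rF)(x_1,\dots,x_{r+2})=\frac1{(r+2)!}\sum_{\pi\in\mathfrak{S}_{r+2}}F(x_{\pi(1)},x_{\pi(2)}),$$ where $\mathfrak{S}_{r+2}$ is the symmetric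 group on $r+2$ elements, and let $\mathcal{T}_r^*\colon M(V^{r+2})\to M(V^2)$ be its adjoint (its image consists of symmetric measures). Let $D=\{(x,x):x\in V\}$ be the diagonal. Then $$\xi_r(G)=\sup\{\mu(V^2) : \mu\in M_{\rm sym}(V)_{\ge0},\ \beta\in M(V^{r+2})_{\ge0},\ \mu=\mathcal{T}_r^*\beta,\ \mu(D)=1,\ \mu_E=0\},$$ where $\mu_E$ is the restriction of $\mu$ to $E\subseteq V^2$. *)

theory Defs
  imports "HOL-Analysis.Analysis"
begin

section \<open>Topological packing graphs\<close>

text \<open>The vertex set is \<open>topspace X\<close>; a graph on it is given by its edge set \<open>E\<close>, a symmetric
  irreflexive relation.\<close>

definition topological_graph :: "'a topology \<Rightarrow> ('a \<times> 'a) set \<Rightarrow> bool" where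
  "topological_graph X E \<longleftrightarrow>
     Hausdorff_space X \<and> E \<subseteq> topspace X \<times> topspace X \<and> sym E \<and> irrefl E"

definition clique :: "'a topology \<Rightarrow> ('a \<times> 'a) set \<Rightarrow> 'a set \<Rightarrow> bool" where
  "clique X E C \<longleftrightarrow> C \<subseteq> topspace X \<and> pairwise (\<lambda>x y. (x, y) \<in> E) C"

definition independent_set :: "'a topology \<Rightarrow> ('a \<times> 'a) set \<Rightarrow> 'a set \<Rightarrow> bool" where
  "independent_set X E S \<longleftrightarrow> S \<subseteq> topspace X \<and> pairwise (\<lambda>x y. (x, y) \<notin> E) S"

definition packing_graph :: "'a topology \<Rightarrow> ('a \<times> 'a) set \<Rightarrow> bool" where
  "packing_graph X E \<longleftrightarrow> topological_graph X E \<and>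
     (\<forall>C. finite C \<and> clique X E C \<longrightarrow> (\<exists>U. openin X U \<and> clique X E U \<and> C \<subseteq> U))"

definition compact_packing_graph :: "'a topology \<Rightarrow> ('a \<times> 'a) set \<Rightarrow> bool" where
  "compact_packing_graph X E \<longleftrightarrow> compact_space X \<and> packing_graph X E"

definition independence_number :: "'a topology \<Rightarrow> ('a \<times> 'a) set \<Rightarrow> enat" where
  "independence_number X E =
     (SUP S\<in>{S. independent_set X E S}. if finite S then enat (card S) else \<infinity>)"


section \<open>Function and measure spaces\<close>

definition borel_of :: "'a topology \<Rightarrow> 'a measure" where
  "borel_of X = sigma (topspace X) {U. openin X U}"

text \<open>Finite nonnegative Radon measures: finite Borel measures that are inner regular with respect
  to compact sets.\<close>

definition radon_measure :: "'a topology \<Rightarrow> 'a measure \<Rightarrow> bool" where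
  "radon_measure X M \<longleftrightarrow> sets M = sets (borel_of X) \<and> finite_measure M \<and>
     (\<forall>A\<in>sets M. emeasure M A = (SUP K\<in>{K. compactin X K \<and> K \<subseteq> A}. emeasure M K))"

text \<open>Elements of $C(X)$ are represented by total functions, whose values outside \<open>topspace X\<close>
  play no role.\<close>

definition C_space :: "'a topology \<Rightarrow> ('a \<Rightarrow> real) set" where
  "C_space X = {f. continuous_map X euclideanreal f}"

text \<open>A signed Radon measure of bounded total variation is a real-valued set function that is the
  difference of two finite nonnegative Radon measures. It vanishes outside the Borel sets by the
  conventions of \<^const>\<open>measure\<close>.\<close>

definition M_space :: "'a topology \<Rightarrow> ('a set \<Rightarrow> real) set" where
  "M_space X = {\<mu>. \<exists>P N. radon_measure X P \<and> radon_measure X N \<and>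
                      \<mu> = (\<lambda>A. measure P A - measure N A)}"

definition M_nonneg :: "'a topology \<Rightarrow> ('a set \<Rightarrow> real) set" where
  "M_nonneg X = {\<mu> \<in> M_space X. \<forall>A\<in>sets (borel_of X). 0 \<le> \<mu> A}"

text \<open>The integral against a signed measure does not depend on the chosen decomposition; see
  \<open>pairing_eq\<close> below.\<close>

definition pairing :: "'a topology \<Rightarrow> ('a \<Rightarrow> real) \<Rightarrow> ('a set \<Rightarrow> real) \<Rightarrow> real" where
  "pairing X f \<mu> = (THE c. \<exists>P N. radon_measure X P \<and> radon_measure X N \<and>
      \<mu> = (\<lambda>A. measure P A - measure N A) \<and> c = (\<integral>x. f x \<partial>P) - (\<integral>x. f x \<partial>N))"

definition invariant_under :: "'a topology \<Rightarrow> ('a \<Rightarrow> 'a) \<Rightarrow> ('a set \<Rightarrow> real) \<Rightarrow> bool" where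
  "invariant_under X \<sigma> \<mu> \<longleftrightarrow> (\<forall>A\<in>sets (borel_of X). \<mu> (\<sigma> ` A) = \<mu> A)"

definition M_sym :: "'a topology \<Rightarrow> (('a \<times> 'a) set \<Rightarrow> real) set" where
  "M_sym X = {\<mu> \<in> M_space (prod_topology X X). invariant_under (prod_topology X X) prod.swap \<mu>}"

definition M_sym_nonneg :: "'a topology \<Rightarrow> (('a \<times> 'a) set \<Rightarrow> real) set" where
  "M_sym_nonneg X = M_sym X \<inter> M_nonneg (prod_topology X X)"

text \<open>\<open>is_adjoint_image Y X \<F> L \<nu> \<mu>\<close> says that \<open>\<mu> = L\<^sup>* \<nu>\<close>, for a linear map \<open>L\<close> from
  the subspace \<open>\<F>\<close> of $C(Y)$ to $C(X)$ and \<open>\<nu>\<close> in $M(X)$.\<close>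

definition is_adjoint_image ::
  "'b topology \<Rightarrow> 'a topology \<Rightarrow> ('b \<Rightarrow> real) set \<Rightarrow> (('b \<Rightarrow> real) \<Rightarrow> 'a \<Rightarrow> real) \<Rightarrow>
   ('a set \<Rightarrow> real) \<Rightarrow> ('b set \<Rightarrow> real) \<Rightarrow> bool" where
  "is_adjoint_image Y X \<F> L \<nu> \<mu> \<longleftrightarrow> (\<forall>F\<in>\<F>. pairing Y F \<mu> = pairing X (L F) \<nu>)"


section \<open>Spaces of subsets\<close>

definition Sub :: "'a set \<Rightarrow> nat \<Rightarrow> 'a set set" where
  "Sub A k = {S. S \<subseteq> A \<and> finite S \<and> card S \<le> k}"

text \<open>$V^k$, as extensional functions on \<open>{..<k}\<close>.\<close>

definition power_top :: "'a topology \<Rightarrow> nat \<Rightarrow> (nat \<Rightarrow> 'a) topology" where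
  "power_top X k = product_topology (\<lambda>_. X) {..<k}"

text \<open>The topology on $\mathrm{Sub}(V,k)$. For \<open>k \<ge> 1\<close> the empty set is not in the image of
  $(v_1,\dots,v_k) \mapsto \{v_1,\dots,v_k\}$, so membership of the empty set in \<open>U\<close> does not affect
  the condition on the preimage: this is the disjoint union of the quotient topology on the nonempty
  sets and of an isolated point. For \<open>k = 0\<close> it is the one-point space.\<close>

definition Sub_top :: "'a topology \<Rightarrow> nat \<Rightarrow> 'a set topology" where
  "Sub_top X k = topology (\<lambda>U. U \<subseteq> Sub (topspace X) k \<and>
      openin (power_top X k) {v \<in> topspace (power_top X k). v ` {..<k} \<in> U})"

definition indep_sets :: "'a topology \<Rightarrow> ('a \<times> 'a) set \<Rightarrow> nat \<Rightarrow> 'a set set" where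
  "indep_sets X E k = {S \<in> Sub (topspace X) k. independent_set X E S}"

definition indep_sets_eq :: "'a topology \<Rightarrow> ('a \<times> 'a) set \<Rightarrow> nat \<Rightarrow> 'a set set" where
  "indep_sets_eq X E k = {S \<in> indep_sets X E k. card S = k}"

definition indep_top :: "'a topology \<Rightarrow> ('a \<times> 'a) set \<Rightarrow> nat \<Rightarrow> 'a set topology" where
  "indep_top X E k = subtopology (Sub_top X k) (indep_sets X E k)"


section \<open>The k-point bound\<close>

text \<open>$\mathcal{I}_1^2 \times \mathcal{I}_{k-2}$, with elements \<open>((S, T), Q)\<close>.\<close>

definition triple_top ::
  "'a topology \<Rightarrow> ('a \<times> 'a) set \<Rightarrow> nat \<Rightarrow> (('a set \<times> 'a set) \<times> 'a set) topology" where
  "triple_top X E k =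
     prod_topology (prod_topology (indep_top X E 1) (indep_top X E 1)) (indep_top X E (k - 2))"

definition C_sym_triple ::
  "'a topology \<Rightarrow> ('a \<times> 'a) set \<Rightarrow> nat \<Rightarrow> (('a set \<times> 'a set) \<times> 'a set \<Rightarrow> real) set" where
  "C_sym_triple X E k = {F \<in> C_space (triple_top X E k).
     \<forall>S\<in>indep_sets X E 1. \<forall>T\<in>indep_sets X E 1. \<forall>Q\<in>indep_sets X E (k - 2).
       F ((S, T), Q) = F ((T, S), Q)}"

definition M_sym_triple ::
  "'a topology \<Rightarrow> ('a \<times> 'a) set \<Rightarrow> nat \<Rightarrow> ((('a set \<times> 'a set) \<times> 'a set) set \<Rightarrow> real) set" where
  "M_sym_triple X E k = {\<mu> \<in> M_space (triple_top X E k).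
     invariant_under (triple_top X E k) (\<lambda>((S, T), Q). ((T, S), Q)) \<mu>}"

text \<open>The sum ranges over subsets \<open>Q\<close> of \<open>I\<close> only: all other \<open>Q\<close> contribute nothing, and
  \<^const>\<open>sum\<close> over an infinite index set would be \<open>0\<close> by convention.\<close>

definition B_op ::
  "nat \<Rightarrow> (('a set \<times> 'a set) \<times> 'a set \<Rightarrow> real) \<Rightarrow> 'a set \<Rightarrow> real" where
  "B_op k F I = (\<Sum>Q\<in>Sub I (k - 2).
      \<Sum>(S, T)\<in>{(S, T). S \<in> Sub I 1 \<and> T \<in> Sub I 1 \<and> Q \<union> S \<union> T = I}. F ((S, T), Q))"

definition psd_kernel_on :: "'a set \<Rightarrow> ('a \<Rightarrow> 'a \<Rightarrow> real) \<Rightarrow> bool" where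
  "psd_kernel_on A K \<longleftrightarrow> (\<forall>x\<in>A. \<forall>y\<in>A. K x y = K y x) \<and>
     (\<forall>S c. finite S \<and> S \<subseteq> A \<longrightarrow> 0 \<le> (\<Sum>x\<in>S. \<Sum>y\<in>S. c x * c y * K x y))"

definition C_psd ::
  "'a topology \<Rightarrow> ('a \<times> 'a) set \<Rightarrow> nat \<Rightarrow> (('a set \<times> 'a set) \<times> 'a set \<Rightarrow> real) set" where
  "C_psd X E k = {F \<in> C_sym_triple X E k.
     \<forall>Q\<in>indep_sets X E (k - 2). psd_kernel_on (indep_sets X E 1) (\<lambda>S T. F ((S, T), Q))}"

definition M_psd ::
  "'a topology \<Rightarrow> ('a \<times> 'a) set \<Rightarrow> nat \<Rightarrow> ((('a set \<times> 'a set) \<times> 'a set) set \<Rightarrow> real) set" where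
  "M_psd X E k = {\<mu> \<in> M_sym_triple X E k. \<forall>F\<in>C_psd X E k. 0 \<le> pairing (triple_top X E k) F \<mu>}"

definition Delta_feasible ::
  "'a topology \<Rightarrow> ('a \<times> 'a) set \<Rightarrow> nat \<Rightarrow> ('a set set \<Rightarrow> real) set" where
  "Delta_feasible X E k = {\<nu> \<in> M_nonneg (indep_top X E k). \<nu> {{}} = 1 \<and>
     (\<exists>\<mu>\<in>M_psd X E k.
        is_adjoint_image (triple_top X E k) (indep_top X E k) (C_sym_triple X E k) (B_op k) \<nu> \<mu>)}"

definition Delta :: "'a topology \<Rightarrow> ('a \<times> 'a) set \<Rightarrow> nat \<Rightarrow> ereal" where
  "Delta X E k = (SUP \<nu>\<in>Delta_feasible X E k. ereal (\<nu> (indep_sets_eq X E 1)))"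


section \<open>The copositive hierarchy\<close>

text \<open>The coordinates $x_1, \dots, x_{r+2}$ are indexed from 0.\<close>

definition T_op :: "nat \<Rightarrow> ('a \<times> 'a \<Rightarrow> real) \<Rightarrow> (nat \<Rightarrow> 'a) \<Rightarrow> real" where
  "T_op r F x =
     1 / fact (r + 2) * (\<Sum>\<pi> | \<pi> permutes {..<r + 2}. F (x (\<pi> 0), x (\<pi> 1)))"

definition xi_feasible ::
  "'a topology \<Rightarrow> ('a \<times> 'a) set \<Rightarrow> nat \<Rightarrow>
   ((('a \<times> 'a) set \<Rightarrow> real) \<times> ((nat \<Rightarrow> 'a) set \<Rightarrow> real)) set" where
  "xi_feasible X E r = {(\<mu>, \<beta>).
     \<mu> \<in> M_sym_nonneg X \<and> \<beta> \<in> M_nonneg (power_top X (r + 2)) \<and>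
     is_adjoint_image (prod_topology X X) (power_top X (r + 2))
       (C_space (prod_topology X X)) (T_op r) \<beta> \<mu> \<and>
     \<mu> {(x, x) | x. x \<in> topspace X} = 1 \<and>
     (\<forall>A\<in>sets (borel_of (prod_topology X X)). \<mu> (A \<inter> E) = 0)}"

definition xi :: "'a topology \<Rightarrow> ('a \<times> 'a) set \<Rightarrow> nat \<Rightarrow> ereal" where
  "xi X E r = (SUP (\<mu>, \<beta>)\<in>xi_feasible X E r. ereal (\<mu> (topspace X \<times> topspace X)))"


section \<open>Basic facts\<close>

lemma independence_number_finite:
  assumes "compact_packing_graph X E"
  shows "independence_number X E < \<infinity>"
proof -
  have comp: "compact_space X"
    and pack: "\<And>C. finite C \<Longrightarrow> clique X E C \<Longrightarrow> \<exists>U. openin X U \<and> clique X E U \<and> C \<subseteq> U"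
    using assms by (auto simp: compact_packing_graph_def packing_graph_def)
  have "topspace X \<subseteq> \<Union>{U. openin X U \<and> clique X E U}"
  proof
    fix x assume "x \<in> topspace X"
    then have "clique X E {x}" by (simp add: clique_def)
    then show "x \<in> \<Union>{U. openin X U \<and> clique X E U}" using pack[of "{x}"] by auto
  qed
  moreover have "\<forall>U\<in>{U. openin X U \<and> clique X E U}. openin X U" by blast
  ultimately obtain \<F> where F: "finite \<F>" "\<F> \<subseteq> {U. openin X U \<and> clique X E U}"
    "topspace X \<subseteq> \<Union>\<F>"
    using comp unfolding compact_space_alt by meson
  have bound: "finite S \<and> card S \<le> card \<F>" if S: "independent_set X E S" for S
  proof -
    have "\<forall>x\<in>S. \<exists>U\<in>\<F>. x \<in> U" using S F(3) by (auto simp: independent_set_def)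
    then obtain u where u: "\<And>x. x \<in> S \<Longrightarrow> u x \<in> \<F> \<and> x \<in> u x" by metis
    have "inj_on u S"
    proof (rule inj_onI, rule ccontr)
      fix x y assume xy: "x \<in> S" "y \<in> S" "u x = u y" "x \<noteq> y"
      then have "clique X E (u x)" "x \<in> u x" "y \<in> u x" using u F(2) by auto
      then have "(x, y) \<in> E" using xy(4) by (auto simp: clique_def pairwise_def)
      then show False using S xy by (auto simp: independent_set_def pairwise_def)
    qed
    moreover have "u ` S \<subseteq> \<F>" using u by blast
    ultimately show ?thesis using F(1) by (meson card_inj_on_le inj_on_finite)
  qed
  have "independence_number X E \<le> enat (card \<F>)"
    unfolding independence_number_def using bound by (intro SUP_least) auto
  then show ?thesis by (metis enat_ord_code(4) order_le_less_trans)
qed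

lemma space_borel_of [simp]: "space (borel_of X) = topspace X"
  by (simp add: borel_of_def space_measure_of_conv)

lemma sets_borel_of: "sets (borel_of X) = sigma_sets (topspace X) {U. openin X U}"
  unfolding borel_of_def by (rule sets_measure_of) (auto dest: openin_subset)

lemma openin_Sub_top:
  "openin (Sub_top X k) U \<longleftrightarrow> U \<subseteq> Sub (topspace X) k \<and>
      openin (power_top X k) {v \<in> topspace (power_top X k). v ` {..<k} \<in> U}"
proof -
  have "istopology (\<lambda>U. U \<subseteq> Sub (topspace X) k \<and>
      openin (power_top X k) {v \<in> topspace (power_top X k). v ` {..<k} \<in> U})"
    (is "istopology ?P")
    unfolding istopology_def
  proof (intro conjI allI impI)
    fix S T assume "?P S" "?P T"
    moreover have "{v \<in> topspace (power_top X k). v ` {..<k} \<in> S \<inter> T} =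
        {v \<in> topspace (power_top X k). v ` {..<k} \<in> S} \<inter>
        {v \<in> topspace (power_top X k). v ` {..<k} \<in> T}" by auto
    ultimately show "S \<inter> T \<subseteq> Sub (topspace X) k"
      and "openin (power_top X k) {v \<in> topspace (power_top X k). v ` {..<k} \<in> S \<inter> T}"
      by (auto intro: openin_Int)
  next
    fix K assume K: "\<forall>S\<in>K. ?P S"
    have "{v \<in> topspace (power_top X k). v ` {..<k} \<in> \<Union>K} =
        (\<Union>S\<in>K. {v \<in> topspace (power_top X k). v ` {..<k} \<in> S})" by auto
    with K show "\<Union>K \<subseteq> Sub (topspace X) k"
      and "openin (power_top X k) {v \<in> topspace (power_top X k). v ` {..<k} \<in> \<Union>K}"
      by (auto intro!: openin_Union)
  qed
  then show ?thesis
    unfolding Sub_top_def by (simp add: topology_inverse')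
qed

lemma image_in_Sub:
  assumes "v \<in> topspace (power_top X k)"
  shows "v ` {..<k} \<in> Sub (topspace X) k"
proof -
  have "card (v ` {..<k}) \<le> k"
    using card_image_le[of "{..<k}" v] by simp
  with assms show ?thesis by (auto simp: Sub_def power_top_def)
qed

lemma topspace_Sub_top [simp]: "topspace (Sub_top X k) = Sub (topspace X) k"
proof -
  have "{v \<in> topspace (power_top X k). v ` {..<k} \<in> Sub (topspace X) k}
          = topspace (power_top X k)"
    using image_in_Sub by blast
  then have "openin (Sub_top X k) (Sub (topspace X) k)"
    by (simp add: openin_Sub_top)
  then show ?thesis
    using openin_Sub_top openin_subset openin_topspace by (metis subset_antisym)
qed

lemma openin_Sub_top_empty: "openin (Sub_top X k) {{}}"
proof -
  have "{v \<in> topspace (power_top X k). v ` {..<k} \<in> {{}}} =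
      (if k = 0 then topspace (power_top X k) else {})" by auto
  then show ?thesis by (simp add: openin_Sub_top Sub_def)
qed

lemma quotient_map_Sub_top:
  assumes "1 \<le> k"
  shows "quotient_map (power_top X k)
           (subtopology (Sub_top X k) (Sub (topspace X) k - {{}})) (\<lambda>v. v ` {..<k})"
  unfolding quotient_map_def
proof (intro conjI allI impI)
  let ?Y = "subtopology (Sub_top X k) (Sub (topspace X) k - {{}})"
  have ne: "v ` {..<k} \<noteq> {}" for v :: "nat \<Rightarrow> 'a"
    using assms by (auto simp: lessThan_empty_iff)
  show "(\<lambda>v. v ` {..<k}) ` topspace (power_top X k) = topspace ?Y"
  proof
    show "(\<lambda>v. v ` {..<k}) ` topspace (power_top X k) \<subseteq> topspace ?Y"
      using image_in_Sub ne by (auto simp: topspace_subtopology)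
    show "topspace ?Y \<subseteq> (\<lambda>v. v ` {..<k}) ` topspace (power_top X k)"
    proof
      fix S assume "S \<in> topspace ?Y"
      then have S: "S \<subseteq> topspace X" "finite S" "card S \<le> k" "S \<noteq> {}"
        by (auto simp: topspace_subtopology Sub_def)
      obtain h where h: "bij_betw h {0..<card S} S"
        using S(2) ex_bij_betw_nat_finite by blast
      have c: "card S > 0" using S by (simp add: card_gt_0_iff)
      define v where "v = (\<lambda>i\<in>{..<k}. if i < card S then h i else h 0)"
      have im: "v ` {..<k} = S"
      proof
        show "v ` {..<k} \<subseteq> S" using h c by (auto simp: v_def bij_betw_def)
        show "S \<subseteq> v ` {..<k}"
        proof
          fix s assume "s \<in> S"
          then obtain i where "i < card S" "h i = s" using h by (metis atLeastLessThan_iff bij_betw_iff_bijections)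
          then have "i \<in> {..<k}" "v i = s" using S(3) by (auto simp: v_def)
          then show "s \<in> v ` {..<k}" by blast
        qed
      qed
      have "v i \<in> topspace X" if "i < k" for i
        using im S(1) that by blast
      moreover have "v \<in> extensional {..<k}" by (simp add: v_def)
      ultimately have "v \<in> topspace (power_top X k)"
        by (auto simp: power_top_def PiE_def)
      with im show "S \<in> (\<lambda>v. v ` {..<k}) ` topspace (power_top X k)" by blast
    qed
  qed
  fix U assume U: "U \<subseteq> topspace ?Y"
  have "openin (Sub_top X k) (Sub (topspace X) k - {{}})"
  proof -
    have "{v \<in> topspace (power_top X k). v ` {..<k} \<in> Sub (topspace X) k - {{}}}
            = topspace (power_top X k)"
      using image_in_Sub ne by blast
    then show ?thesis by (simp add: openin_Sub_top)
  qed
  then have "openin ?Y U \<longleftrightarrow> openin (Sub_top X k) U"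
    using U by (simp add: openin_open_subtopology topspace_subtopology)
  then show "openin (power_top X k) {x \<in> topspace (power_top X k). x ` {..<k} \<in> U} = openin ?Y U"
    using U by (auto simp: openin_Sub_top topspace_subtopology)
qed

lemma nn_integral_add_eq:
  assumes sets: "sets N = sets M" "sets P = sets M" "sets Q = sets M"
    and eq: "\<And>A. A \<in> sets M \<Longrightarrow> emeasure M A + emeasure N A = emeasure P A + emeasure Q A"
    and f: "f \<in> borel_measurable M"
  shows "nn_integral M f + nn_integral N f = nn_integral P f + nn_integral Q f"
proof -
  note sp = sets_eq_imp_space_eq[OF sets(1)] sets_eq_imp_space_eq[OF sets(2)]
    sets_eq_imp_space_eq[OF sets(3)]
  note me = measurable_cong_sets[OF sets(1) refl] measurable_cong_sets[OF sets(2) refl]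
    measurable_cong_sets[OF sets(3) refl]
  show ?thesis
    using f
  proof (induction rule: borel_measurable_induct)
    case (cong f g)
    then have "nn_integral M f = nn_integral M g" "nn_integral N f = nn_integral N g"
      "nn_integral P f = nn_integral P g" "nn_integral Q f = nn_integral Q g"
      by (auto intro!: nn_integral_cong simp: sp)
    with cong show ?case by simp
  next
    case (set A)
    then show ?case using eq[OF set] by (simp add: sets)
  next
    case (mult u c)
    then show ?case
      by (simp add: nn_integral_cmult me flip: distrib_left)
  next
    case (add u v)
    have "nn_integral M (\<lambda>x. v x + u x) + nn_integral N (\<lambda>x. v x + u x)
       = (nn_integral M v + nn_integral N v) + (nn_integral M u + nn_integral N u)"
      using add by (simp add: nn_integral_add me ac_simps)
    also have "\<dots> = (nn_integral P v + nn_integral Q v) + (nn_integral P u + nn_integral Q u)"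
      using add by simp
    also have "\<dots> = nn_integral P (\<lambda>x. v x + u x) + nn_integral Q (\<lambda>x. v x + u x)"
      using add by (simp add: nn_integral_add me ac_simps)
    finally show ?case .
  next
    case (seq U)
    have mc: "nn_integral R (Sup (range U)) = (SUP i. nn_integral R (U i))"
      if "sets R = sets M" for R
    proof -
      have "nn_integral R (\<lambda>x. SUP i. U i x) = (SUP i. nn_integral R (U i))"
        using seq by (intro nn_integral_monotone_convergence_SUP)
          (auto simp: measurable_cong_sets[OF that refl])
      moreover have "Sup (range U) = (\<lambda>x. SUP i. U i x)" by (auto simp: image_comp)
      ultimately show ?thesis by simp
    qed
    have inc: "incseq (\<lambda>i. nn_integral R (U i))" for R
      using seq(3) by (auto simp: incseq_def le_fun_def intro!: nn_integral_mono)
    have sup: "f = Sup (range U)" by fact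
    show ?case
      unfolding sup mc[OF refl] mc[OF sets(1)] mc[OF sets(2)] mc[OF sets(3)]
        ennreal_SUP_add[OF inc inc, symmetric]
      using seq by simp
  qed
qed

lemma continuous_map_borel_of:
  assumes "continuous_map X euclideanreal f" "sets M = sets (borel_of X)"
  shows "f \<in> borel_measurable M"
proof (rule borel_measurableI)
  fix S :: "real set" assume "open S"
  then have "openin X {x \<in> topspace X. f x \<in> S}"
    using assms(1) by (auto simp: continuous_map_def)
  moreover have "space M = topspace X"
    using sets_eq_imp_space_eq[OF assms(2)] by simp
  ultimately show "f -` S \<inter> space M \<in> sets M"
    by (auto simp: assms(2) sets_borel_of vimage_def Int_def conj_commute intro: sigma_sets.Basic)
qed

lemma pairing_eq:
  assumes X: "compact_space X" and f: "f \<in> C_space X"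
    and P: "radon_measure X P" and N: "radon_measure X N"
  shows "pairing X f (\<lambda>A. measure P A - measure N A) = (\<integral>x. f x \<partial>P) - (\<integral>x. f x \<partial>N)"
proof -
  have cont: "continuous_map X euclideanreal f" using f by (simp add: C_space_def)
  have "compact (f ` topspace X)"
    using image_compactin[OF _ cont] X by (simp add: compact_space_def)
  then obtain B where B: "\<And>x. x \<in> topspace X \<Longrightarrow> \<bar>f x\<bar> \<le> B"
    using compact_imp_bounded bounded_iff by (metis imageI real_norm_def)
  have uniq: "(\<integral>x. f x \<partial>P') - (\<integral>x. f x \<partial>N') = (\<integral>x. f x \<partial>P) - (\<integral>x. f x \<partial>N)"
    if P': "radon_measure X P'" and N': "radon_measure X N'"
      and e: "(\<lambda>A. measure P A - measure N A) = (\<lambda>A. measure P' A - measure N' A)" for P' N'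
  proof -
    have s: "sets R = sets (borel_of X) \<and> finite_measure R \<and> space R = topspace X"
      if "radon_measure X R" for R
      using that sets_eq_imp_space_eq[of R "borel_of X"] by (auto simp: radon_measure_def)
    have int: "integrable R f" "integrable R (\<lambda>x. f x + \<bar>B\<bar>)"
      "ennreal (\<integral>x. f x + \<bar>B\<bar> \<partial>R) = (\<integral>\<^sup>+x. ennreal (f x + \<bar>B\<bar>) \<partial>R)"
      "0 \<le> (\<integral>x. f x + \<bar>B\<bar> \<partial>R)"
      "(\<integral>x. f x + \<bar>B\<bar> \<partial>R) = (\<integral>x. f x \<partial>R) + \<bar>B\<bar> * measure R (topspace X)"
      if "radon_measure X R" for R
    proof -
      interpret finite_measure R using s[OF that] by blast
      show i: "integrable R f"
        using s[OF that] B cont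
        by (intro integrable_const_bound[where B = B] continuous_map_borel_of) auto
      then show i2: "integrable R (\<lambda>x. f x + \<bar>B\<bar>)" by simp
      have nn: "0 \<le> f x + \<bar>B\<bar>" if "x \<in> topspace X" for x using B[OF that] by linarith
      show "ennreal (\<integral>x. f x + \<bar>B\<bar> \<partial>R) = (\<integral>\<^sup>+x. ennreal (f x + \<bar>B\<bar>) \<partial>R)"
        using nn s[OF that] by (intro nn_integral_eq_integral[OF i2, symmetric]) auto
      show "0 \<le> (\<integral>x. f x + \<bar>B\<bar> \<partial>R)"
        using nn s[OF that] by (intro Bochner_Integration.integral_nonneg_AE) auto
      show "(\<integral>x. f x + \<bar>B\<bar> \<partial>R) = (\<integral>x. f x \<partial>R) + \<bar>B\<bar> * measure R (topspace X)"
        using i s[OF that] by (simp add: Bochner_Integration.integral_add)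
    qed
    have em: "emeasure P A + emeasure N' A = emeasure P' A + emeasure N A" for A
    proof -
      have "measure P A + measure N' A = measure P' A + measure N A"
        using fun_cong[OF e, of A] by linarith
      then have "ennreal (measure P A) + ennreal (measure N' A) =
          ennreal (measure P' A) + ennreal (measure N A)"
        by (simp flip: ennreal_plus)
      then show ?thesis
        using s[OF P] s[OF N] s[OF P'] s[OF N'] by (simp add: finite_measure.emeasure_eq_measure)
    qed
    have "(\<integral>\<^sup>+x. ennreal (f x + \<bar>B\<bar>) \<partial>P) + (\<integral>\<^sup>+x. ennreal (f x + \<bar>B\<bar>) \<partial>N')
        = (\<integral>\<^sup>+x. ennreal (f x + \<bar>B\<bar>) \<partial>P') + (\<integral>\<^sup>+x. ennreal (f x + \<bar>B\<bar>) \<partial>N)"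
    proof (rule nn_integral_add_eq)
      have "f \<in> borel_measurable P" using int(1)[OF P] by simp
      then show "(\<lambda>x. ennreal (f x + \<bar>B\<bar>)) \<in> borel_measurable P" by simp
    qed (use s[OF P] s[OF N] s[OF P'] s[OF N'] em in auto)
    then have "ennreal ((\<integral>x. f x + \<bar>B\<bar> \<partial>P) + (\<integral>x. f x + \<bar>B\<bar> \<partial>N')) =
        ennreal ((\<integral>x. f x + \<bar>B\<bar> \<partial>P') + (\<integral>x. f x + \<bar>B\<bar> \<partial>N))"
      using int(3,4) P N P' N' by (simp add: ennreal_plus)
    then have "(\<integral>x. f x + \<bar>B\<bar> \<partial>P) + (\<integral>x. f x + \<bar>B\<bar> \<partial>N') =
        (\<integral>x. f x + \<bar>B\<bar> \<partial>P') + (\<integral>x. f x + \<bar>B\<bar> \<partial>N)"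
      by (subst (asm) ennreal_inj) (use int(4) P N P' N' in auto)
    moreover have "\<bar>B\<bar> * measure P (topspace X) - \<bar>B\<bar> * measure N (topspace X) =
        \<bar>B\<bar> * measure P' (topspace X) - \<bar>B\<bar> * measure N' (topspace X)"
      using fun_cong[OF e, of "topspace X"] by (simp flip: right_diff_distrib)
    ultimately show ?thesis
      using int(5)[OF P] int(5)[OF N] int(5)[OF P'] int(5)[OF N'] by linarith
  qed
  show ?thesis
    unfolding pairing_def
    by (rule the_equality) (use P N uniq in blast)+
qed

end

theory Submission
  imports Defs
begin

text \<open>
  Let \<open>a\<close> be the independence number, which is finite and attained by an independent set \<open>W\<close>. Both
  hierarchies are controlled by measures with finitely many atoms and by one explicit dual certificate.

  The \<open>k\<close>-point bound is at least \<open>a\<close> for \<open>k \<ge> 2\<close>: the sum of the Dirac measures at the subsets of \<open>W\<close> is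
  feasible (\<open>Delta_ge_card_independent\<close>). Its image under the adjoint of \<open>B_k\<close> pairs a kernel with
  all triples of subsets of \<open>W\<close>, which is nonnegative on psd kernels.

  The \<open>k\<close>-point bound is at most \<open>a\<close> already for \<open>k \<ge> a + 1\<close> (\<open>Delta_le_independence_bound\<close>). When
  \<open>\<nu>\<close> comes from a random independent set of size \<open>w\<close>, the claim is that \<open>a - w\<close> has nonnegative
  expectation; for every feasible \<open>\<nu>\<close>, the psd constraints express nonnegativity of the expectation of
  $\binom{w}{q}(a-w)^2$ when \<open>q \<le> k - 2\<close>. Now $1/(a-w)$ is a combination of
  the $\binom{w}{q}$ with \<open>q < a\<close> for \<open>w < a\<close>, with nonnegative coefficients because its forward differences
  are nonnegative. Multiplying by $(a-w)^2$ writes \<open>a - w\<close> as a combination of the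
  constrained expressions. By Moebius inversion the resulting kernel \<open>F\<close> satisfies $B_kF = a$ at the empty
  set, $-1$ at singletons and 0 elsewhere, so pairing with a feasible measure gives the bound. The kernel
  depends on cardinalities only, and these are locally constant in a packing graph.

  The copositive bound is at least \<open>a\<close>, by the uniform distribution on tuples in \<open>W\<close>
  (\<open>card_independent_le_xi\<close>), and infinite when \<open>r + 2 \<le> a\<close>, because a tuple of distinct vertices can then
  receive arbitrarily large mass (\<open>xi_infinite\<close>). So the comparison of the hierarchies is trivial when
  \<open>r + 2 \<le> a\<close>, and otherwise \<open>a\<close> lies between the two values.

  For these measures to be admissible, the spaces of independent sets must be compact with closed points,
  and \<open>B_k\<close> must map continuous functions to continuous functions. The continuity rests on the fact that the independent
  sets close to \<open>I\<close> arise by moving each point of \<open>I\<close> a little (\<open>independent_set_neighbourhood\<close>).\<close>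

section \<open>Finitely supported measures\<close>

definition atomic_measure :: "'b topology \<Rightarrow> 'i set \<Rightarrow> ('i \<Rightarrow> real) \<Rightarrow> ('i \<Rightarrow> 'b) \<Rightarrow> 'b measure" where
  "atomic_measure Y K w p = distr (point_measure K (\<lambda>i. ennreal (w i))) (borel_of Y) p"

lemma openin_in_borel_of: "openin Y A \<Longrightarrow> A \<in> sets (borel_of Y)"
  by (auto simp: sets_borel_of)

lemma closedin_in_borel_of:
  assumes "closedin Y A"
  shows "A \<in> sets (borel_of Y)"
proof -
  have "space (borel_of Y) - (topspace Y - A) \<in> sets (borel_of Y)"
    using assms by (intro sets.compl_sets openin_in_borel_of) (auto simp: closedin_def)
  moreover have "space (borel_of Y) - (topspace Y - A) = A"
    using assms by (auto dest: closedin_subset)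
  ultimately show ?thesis by simp
qed

text \<open>This serves as the negative part in the decomposition of a nonnegative measure.\<close>

lemma radon_null_measure: "radon_measure Y (null_measure (borel_of Y))"
proof -
  have "(SUP K\<in>{K. compactin Y K \<and> K \<subseteq> A}. 0::ennreal) = 0" for A
    by (rule antisym[OF SUP_least]) auto
  then show ?thesis
    by (auto simp: radon_measure_def intro!: finite_measureI)
qed

text \<open>The measure that puts mass \<open>w i\<close> at the point \<open>p i\<close>. Points may coincide, so images of such
  measures under a map are again of this form with the same index set; only the points change.\<close>

locale finite_atoms =
  fixes Y :: "'b topology" and K :: "'i set" and w :: "'i \<Rightarrow> real" and p :: "'i \<Rightarrow> 'b"
  assumes fin: "finite K" and nonneg: "\<And>i. i \<in> K \<Longrightarrow> 0 \<le> w i"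
    and into: "\<And>i. i \<in> K \<Longrightarrow> p i \<in> topspace Y"
begin

abbreviation "\<rho> \<equiv> atomic_measure Y K w p"

lemma p_measurable: "p \<in> point_measure K (\<lambda>i. ennreal (w i)) \<rightarrow>\<^sub>M borel_of Y"
  by (rule measurableI) (auto simp: into space_point_measure sets_point_measure)

lemma sets_atomic [simp]: "sets \<rho> = sets (borel_of Y)"
  by (simp add: atomic_measure_def)

lemma emeasure_atomic:
  assumes "A \<in> sets (borel_of Y)"
  shows "emeasure \<rho> A = ennreal (\<Sum>i\<in>K. w i * indicator A (p i))"
proof -
  have "emeasure \<rho> A = (\<Sum>i\<in>p -` A \<inter> K. ennreal (w i))"
    unfolding atomic_measure_def using assms p_measurable fin
    by (simp add: emeasure_distr space_point_measure emeasure_point_measure_finite)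
  also have "\<dots> = ennreal (\<Sum>i\<in>p -` A \<inter> K. w i)"
    by (intro sum_ennreal) (simp add: nonneg)
  also have "(\<Sum>i\<in>p -` A \<inter> K. w i) = (\<Sum>i\<in>K. w i * indicator A (p i))"
    by (rule sum.mono_neutral_cong_left) (auto simp: fin indicator_def)
  finally show ?thesis .
qed

lemma measure_atomic:
  assumes "A \<in> sets (borel_of Y)"
  shows "measure \<rho> A = (\<Sum>i\<in>K. w i * indicator A (p i))"
  unfolding measure_def emeasure_atomic[OF assms]
  by (intro enn2real_ennreal sum_nonneg) (simp add: nonneg)

lemma integral_atomic:
  assumes "f \<in> C_space Y"
  shows "(\<integral>y. f y \<partial>\<rho>) = (\<Sum>i\<in>K. w i * f (p i))"
proof -
  have "f \<in> borel_measurable (borel_of Y)"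
    using assms by (intro continuous_map_borel_of) (auto simp: C_space_def)
  then show ?thesis
    unfolding atomic_measure_def
    by (simp add: integral_distr[OF p_measurable] lebesgue_integral_point_measure_finite fin nonneg)
qed

text \<open>All the mass of a Borel set \<open>A\<close> sits on the finite set \<open>p ` K \<inter> A\<close>, which is compact, and Borel
  because points are closed.\<close>

lemma radon_atomic:
  assumes T1: "t1_space Y"
  shows "radon_measure Y \<rho>"
  unfolding radon_measure_def
proof (intro conjI ballI)
  show "finite_measure \<rho>"
    by (rule finite_measureI)
      (simp add: emeasure_atomic[OF sets.top] sets_eq_imp_space_eq[OF sets_atomic] flip: space_borel_of)
next
  fix A assume A: "A \<in> sets \<rho>"
  let ?K = "p ` K \<inter> A"
  have "?K \<subseteq> topspace Y" using into by auto
  then have "closedin Y ?K" "compactin Y ?K"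
    using T1 fin by (auto simp: t1_space_closedin_finite finite_imp_compactin)
  then have "emeasure \<rho> A = emeasure \<rho> ?K"
    using A by (simp add: emeasure_atomic closedin_in_borel_of)
      (intro arg_cong[of _ _ ennreal] sum.cong, auto simp: indicator_def)
  also have "\<dots> \<le> (SUP K\<in>{K. compactin Y K \<and> K \<subseteq> A}. emeasure \<rho> K)"
    using \<open>compactin Y ?K\<close> by (intro SUP_upper) auto
  finally show "emeasure \<rho> A = (SUP K\<in>{K. compactin Y K \<and> K \<subseteq> A}. emeasure \<rho> K)"
    using A by (intro antisym SUP_least emeasure_mono) auto
qed simp

lemma atomic_difference: "measure \<rho> = (\<lambda>A. measure \<rho> A - measure (null_measure (borel_of Y)) A)"
  by (rule ext) simp

lemma atomic_in_M_nonneg: "t1_space Y \<Longrightarrow> measure \<rho> \<in> M_nonneg Y"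
  unfolding M_nonneg_def M_space_def mem_Collect_eq
  using radon_atomic radon_null_measure atomic_difference
  by (metis measure_nonneg)

lemma pairing_atomic:
  assumes "t1_space Y" "compact_space Y" "f \<in> C_space Y"
  shows "pairing Y f (measure \<rho>) = (\<Sum>i\<in>K. w i * f (p i))"
proof -
  have "pairing Y f (measure \<rho>) = (\<integral>y. f y \<partial>\<rho>) - (\<integral>y. f y \<partial>null_measure (borel_of Y))"
    using assms radon_atomic radon_null_measure by (subst atomic_difference) (rule pairing_eq)
  then show ?thesis using integral_atomic assms(3) by (simp add: integral_null_measure)
qed

text \<open>A symmetry of the space that permutes the weighted atoms leaves the measure invariant. Since \<open>\<sigma>\<close> is an
  involution, the image of a Borel set is also a preimage, hence Borel.\<close>

lemma atomic_invariant:
  assumes \<sigma>: "continuous_map Y Y \<sigma>" and inv: "\<And>y. y \<in> topspace Y \<Longrightarrow> \<sigma> (\<sigma> y) = y"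
    and \<tau>: "bij_betw \<tau> K K" and w: "\<And>i. i \<in> K \<Longrightarrow> w (\<tau> i) = w i"
    and p: "\<And>i. i \<in> K \<Longrightarrow> p (\<tau> i) = \<sigma> (p i)"
  shows "invariant_under Y \<sigma> (measure \<rho>)"
  unfolding invariant_under_def
proof
  fix A assume A: "A \<in> sets (borel_of Y)"
  have sub: "A \<subseteq> topspace Y" using sets.sets_into_space[OF A] by simp
  have maps: "\<sigma> y \<in> topspace Y" if "y \<in> topspace Y" for y
    using \<sigma> that by (auto simp: continuous_map_def)
  have "\<sigma> \<in> borel_of Y \<rightarrow>\<^sub>M borel_of Y"
    unfolding borel_of_def
  proof (rule measurable_sigma_sets[OF sets_measure_of])
    fix U assume "U \<in> {U. openin Y U}"
    then show "\<sigma> -` U \<inter> space (sigma (topspace Y) {U. openin Y U}) \<in>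
        sets (sigma (topspace Y) {U. openin Y U})"
      using openin_continuous_map_preimage[OF \<sigma>, of U] openin_in_borel_of[of Y]
      by (simp add: borel_of_def space_measure_of_conv vimage_def Int_def conj_commute)
  qed (use maps in \<open>auto dest: openin_subset simp: space_measure_of_conv\<close>)
  from measurable_sets[OF this A] have "\<sigma> -` A \<inter> topspace Y \<in> sets (borel_of Y)" by simp
  moreover have pre: "\<sigma> ` A = \<sigma> -` A \<inter> topspace Y"
    using sub maps inv by (auto simp: image_iff) (metis subsetD)+
  ultimately have meas: "\<sigma> ` A \<in> sets (borel_of Y)" by simp
  have "measure \<rho> (\<sigma> ` A) = (\<Sum>i\<in>K. w i * indicator (\<sigma> ` A) (p i))"
    by (rule measure_atomic[OF meas])
  also have "\<dots> = (\<Sum>i\<in>K. w (\<tau> i) * indicator A (p (\<tau> i)))"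
    by (intro sum.cong refl) (auto simp: w p pre into indicator_def)
  also have "\<dots> = (\<Sum>i\<in>K. w i * indicator A (p i))"
    by (rule sum.reindex_bij_betw[OF \<tau>])
  also have "\<dots> = measure \<rho> A" by (rule measure_atomic[OF A, symmetric])
  finally show "measure \<rho> (\<sigma> ` A) = measure \<rho> A" .
qed

end

section \<open>The topology of the space of independent sets\<close>

lemma openin_Sub_top_subset:
  assumes "openin X U"
  shows "openin (Sub_top X k) {S \<in> Sub (topspace X) k. S \<subseteq> U}"
proof -
  have "{v \<in> topspace (power_top X k). v ` {..<k} \<in> {S \<in> Sub (topspace X) k. S \<subseteq> U}}
      = PiE {..<k} (\<lambda>_. U)"
  proof (intro set_eqI iffI)
    fix v assume "v \<in> PiE {..<k} (\<lambda>_. U)"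
    moreover from this have "v \<in> topspace (power_top X k)"
      using openin_subset[OF assms] by (auto simp: power_top_def PiE_iff)
    ultimately show "v \<in> {v \<in> topspace (power_top X k).
        v ` {..<k} \<in> {S \<in> Sub (topspace X) k. S \<subseteq> U}}"
      using image_in_Sub by blast
  qed (auto simp: power_top_def PiE_iff)
  then show ?thesis
    using assms by (auto simp: openin_Sub_top power_top_def openin_PiE)
qed

lemma openin_Sub_top_meets:
  assumes "openin X U"
  shows "openin (Sub_top X k) {S \<in> Sub (topspace X) k. S \<inter> U \<noteq> {}}"
proof -
  have "{v \<in> topspace (power_top X k). v ` {..<k} \<in> {S \<in> Sub (topspace X) k. S \<inter> U \<noteq> {}}}
      = (\<Union>i<k. {v \<in> topspace (power_top X k). v i \<in> U})"
    using image_in_Sub[of _ X k] by auto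
  moreover have "openin (power_top X k) {v \<in> topspace (power_top X k). v i \<in> U}" if "i < k" for i
    unfolding power_top_def using that assms
    by (intro openin_continuous_map_preimage[OF continuous_map_product_projection]) auto
  ultimately show ?thesis
    by (auto simp: openin_Sub_top)
qed

text \<open>Whether \<open>S\<close> or \<open>T\<close> has a point outside the other, the two kinds of open sets above, meeting the
  complement of \<open>T\<close> or avoiding a point, separate \<open>S\<close> from \<open>T\<close>.\<close>

lemma t1_space_Sub_top:
  assumes "t1_space X"
  shows "t1_space (Sub_top X k)"
  unfolding t1_space_def
proof (intro ballI impI)
  fix S T assume ST: "S \<in> topspace (Sub_top X k)" "T \<in> topspace (Sub_top X k)" "S \<noteq> T"
  then consider x where "x \<in> S" "x \<notin> T" | x where "x \<in> T" "x \<notin> S" by auto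
  then show "\<exists>U. openin (Sub_top X k) U \<and> S \<in> U \<and> T \<notin> U"
  proof cases
    case 1
    have "openin X (topspace X - T)"
      using assms ST by (auto simp: t1_space_closedin_finite closedin_def Sub_def)
    from openin_Sub_top_meets[OF this, of k] 1 ST show ?thesis
      by (intro exI[of _ "{S' \<in> Sub (topspace X) k. S' \<inter> (topspace X - T) \<noteq> {}}"])
        (auto simp: Sub_def)
  next
    case 2
    have "openin X (topspace X - {x})"
      using assms 2 ST by (auto simp: t1_space_closedin_finite closedin_def Sub_def)
    from openin_Sub_top_subset[OF this, of k] 2 ST show ?thesis
      by (intro exI[of _ "{S' \<in> Sub (topspace X) k. S' \<subseteq> topspace X - {x}}"])
        (auto simp: Sub_def)
  qed
qed

lemma continuous_map_image_Sub: "continuous_map (power_top X k) (Sub_top X k) (\<lambda>v. v ` {..<k})"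
  unfolding continuous_map_def
  using image_in_Sub by (auto simp: openin_Sub_top)

lemma compact_space_Sub_top:
  assumes "compact_space X"
  shows "compact_space (Sub_top X k)"
proof -
  have "compact_space (power_top X k)"
    using assms by (simp add: power_top_def compact_space_product_topology)
  then have "compactin (Sub_top X k) ((\<lambda>v. v ` {..<k}) ` topspace (power_top X k))"
    using image_compactin[OF _ continuous_map_image_Sub] by (auto simp: compact_space_def)
  moreover have "compactin (Sub_top X k) {{}}"
    by (simp add: Sub_def)
  moreover have "Sub (topspace X) k = (\<lambda>v. v ` {..<k}) ` topspace (power_top X k) \<union> {{}}"
  proof (cases "k = 0")
    case False
    then have "(\<lambda>v. v ` {..<k}) ` topspace (power_top X k) = Sub (topspace X) k - {{}}"
      using quotient_imp_surjective_map[OF quotient_map_Sub_top[of k X]]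
      by (auto simp: topspace_subtopology)
    moreover have "{} \<in> Sub (topspace X) k" by (simp add: Sub_def)
    ultimately show ?thesis by blast
  qed (auto simp: Sub_def power_top_def)
  ultimately show ?thesis
    unfolding compact_space_def by (metis compactin_Un topspace_Sub_top)
qed

lemma Hausdorff_space_packing: "packing_graph X E \<Longrightarrow> Hausdorff_space X"
  by (simp add: packing_graph_def topological_graph_def)

lemma indep_sets_subset_Sub: "indep_sets X E k \<subseteq> Sub (topspace X) k"
  by (auto simp: indep_sets_def)

lemma topspace_indep_top [simp]: "topspace (indep_top X E k) = indep_sets X E k"
  using indep_sets_subset_Sub by (auto simp: indep_top_def topspace_subtopology)

lemma finite_indep_sets: "I \<in> indep_sets X E k \<Longrightarrow> finite I"
  by (auto simp: indep_sets_def Sub_def)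

text \<open>An edge between two points persists when the points move slightly: a packing graph has an open
  clique containing both, and the Hausdorff property keeps the points apart.\<close>

lemma closedin_indep_sets:
  assumes pack: "packing_graph X E"
  shows "closedin (Sub_top X k) (indep_sets X E k)"
  unfolding closedin_def
proof (intro conjI)
  show "openin (Sub_top X k) (topspace (Sub_top X k) - indep_sets X E k)"
  proof (subst openin_subopen, rule ballI)
    fix S assume S: "S \<in> topspace (Sub_top X k) - indep_sets X E k"
    then obtain x y where xy: "x \<in> S" "y \<in> S" "x \<noteq> y" "(x, y) \<in> E"
      by (auto simp: indep_sets_def independent_set_def pairwise_def Sub_def)
    have top: "x \<in> topspace X" "y \<in> topspace X" using S xy by (auto simp: Sub_def)
    have "(y, x) \<in> E"
      using pack xy by (auto simp: packing_graph_def topological_graph_def sym_def)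
    then have "clique X E {x, y}" using xy top by (auto simp: clique_def pairwise_def)
    then obtain C where C: "openin X C" "clique X E C" "x \<in> C" "y \<in> C"
      using pack by (auto simp: packing_graph_def dest!: spec[of _ "{x, y}"])
    obtain A B where AB: "openin X A" "openin X B" "x \<in> A" "y \<in> B" "disjnt A B"
      using Hausdorff_space_packing[OF pack] top xy unfolding Hausdorff_space_def by meson
    let ?T = "{T \<in> Sub (topspace X) k. T \<inter> (C \<inter> A) \<noteq> {}} \<inter>
              {T \<in> Sub (topspace X) k. T \<inter> (C \<inter> B) \<noteq> {}}"
    have "?T \<subseteq> topspace (Sub_top X k) - indep_sets X E k"
    proof
      fix T assume T: "T \<in> ?T"
      then obtain a b where ab: "a \<in> T" "b \<in> T" "a \<in> C \<inter> A" "b \<in> C \<inter> B" by auto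
      then have "a \<noteq> b" using AB by (auto simp: disjnt_def)
      then have "(a, b) \<in> E" using C ab by (auto simp: clique_def pairwise_def)
      then show "T \<in> topspace (Sub_top X k) - indep_sets X E k"
        using T ab \<open>a \<noteq> b\<close> by (auto simp: indep_sets_def independent_set_def pairwise_def)
    qed
    moreover have "openin (Sub_top X k) ?T"
      using AB C by (intro openin_Int openin_Sub_top_meets) auto
    moreover have "S \<in> ?T" using S xy C AB by auto
    ultimately show "\<exists>T. openin (Sub_top X k) T \<and> S \<in> T \<and>
        T \<subseteq> topspace (Sub_top X k) - indep_sets X E k" by blast
  qed
qed (simp add: indep_sets_subset_Sub)

lemma indep_top_compact_t1:
  assumes "compact_packing_graph X E"
  shows "compact_space (indep_top X E k)" "t1_space (indep_top X E k)"
proof -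
  have X: "compact_space X" "packing_graph X E" "t1_space X"
    using assms Hausdorff_space_packing
    by (auto simp: compact_packing_graph_def intro!: Hausdorff_imp_t1_space)
  show "compact_space (indep_top X E k)"
    unfolding indep_top_def
    by (rule compact_space_subtopology, rule closedin_compact_space)
      (rule compact_space_Sub_top[OF X(1)] closedin_indep_sets[OF X(2)])+
  show "t1_space (indep_top X E k)"
    unfolding indep_top_def using X by (intro t1_space_subtopology t1_space_Sub_top)
qed

lemma triple_top_compact_t1:
  assumes "compact_packing_graph X E"
  shows "compact_space (triple_top X E k)" "t1_space (triple_top X E k)"
  unfolding triple_top_def compact_space_prod_topology t1_space_prod_topology
  by (intro disjI2 conjI indep_top_compact_t1[OF assms])+

text \<open>The independent sets near \<open>I\<close> are perturbations of \<open>I\<close>, one nearby point for each point of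
  \<open>I\<close>. The packing property enters here: around each point of \<open>I\<close> there is an open clique, and an
  independent set has at most one point in a clique. So points can neither split nor appear.\<close>

lemma independent_set_neighbourhood:
  assumes pack: "packing_graph X E" and I: "I \<in> indep_sets X E k"
    and W: "\<And>s. s \<in> I \<Longrightarrow> openin X (W s) \<and> s \<in> W s"
  shows "\<exists>N. openin (indep_top X E k) N \<and> I \<in> N \<and>
           (\<forall>J\<in>N. \<exists>b. inj_on b I \<and> J = b ` I \<and> (\<forall>s\<in>I. b s \<in> W s))"
proof -
  have finI: "finite I" and Isub: "I \<subseteq> topspace X" and ISub: "I \<in> Sub (topspace X) k"
    using I by (auto simp: indep_sets_def Sub_def)
  have "\<exists>C. openin X C \<and> clique X E C \<and> s \<in> C" if "s \<in> I" for s
  proof -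
    have "finite {s} \<and> clique X E {s}" using that Isub by (auto simp: clique_def)
    then show ?thesis using pack unfolding packing_graph_def by (metis insert_subset)
  qed
  then obtain C where C: "\<And>s. s \<in> I \<Longrightarrow> openin X (C s) \<and> clique X E (C s) \<and> s \<in> C s"
    by metis
  have "\<exists>A B. openin X A \<and> openin X B \<and> s \<in> A \<and> t \<in> B \<and> disjnt A B"
    if "s \<in> I" "t \<in> I" "s \<noteq> t" for s t
    using Hausdorff_space_packing[OF pack] that Isub unfolding Hausdorff_space_def by blast
  then obtain A B where AB: "\<And>s t. s \<in> I \<Longrightarrow> t \<in> I \<Longrightarrow> s \<noteq> t \<Longrightarrow>
      openin X (A s t) \<and> openin X (B s t) \<and> s \<in> A s t \<and> t \<in> B s t \<and> disjnt (A s t) (B s t)"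
    by metis
  define U where "U s = W s \<inter> C s \<inter> ((\<Inter>t\<in>I - {s}. A s t \<inter> B t s) \<inter> topspace X)" for s
  have Uopen: "openin X (U s)" if "s \<in> I" for s
    unfolding U_def using W C AB finI that
    by (intro openin_Int[OF openin_Int] openin_INT) auto
  have Uin: "s \<in> U s" if "s \<in> I" for s
    unfolding U_def using W C AB Isub that by auto
  have Udisj: "U s \<inter> U t = {}" if "s \<in> I" "t \<in> I" "s \<noteq> t" for s t
    unfolding U_def using AB[OF that] that by (auto simp: disjnt_def)
  define N where "N = indep_sets X E k \<inter> ({J \<in> Sub (topspace X) k. J \<subseteq> (\<Union>s\<in>I. U s)} \<inter>
      ((\<Inter>s\<in>I. {J \<in> Sub (topspace X) k. J \<inter> U s \<noteq> {}}) \<inter> topspace (Sub_top X k)))"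
  have "openin (Sub_top X k) ({J \<in> Sub (topspace X) k. J \<subseteq> (\<Union>s\<in>I. U s)} \<inter>
      ((\<Inter>s\<in>I. {J \<in> Sub (topspace X) k. J \<inter> U s \<noteq> {}}) \<inter> topspace (Sub_top X k)))"
    using finI Uopen
    by (intro openin_Int openin_INT openin_Sub_top_meets openin_Sub_top_subset openin_Union) auto
  then have "openin (indep_top X E k) N"
    unfolding N_def indep_top_def by (rule openin_subtopology_Int2)
  moreover have "I \<in> N" using I ISub Uin by (auto simp: N_def)
  moreover have "\<exists>b. inj_on b I \<and> J = b ` I \<and> (\<forall>s\<in>I. b s \<in> W s)" if J: "J \<in> N" for J
  proof -
    have "\<exists>y. y \<in> J \<inter> U s" if "s \<in> I" for s using J that by (auto simp: N_def)
    then obtain b where b: "\<And>s. s \<in> I \<Longrightarrow> b s \<in> J \<and> b s \<in> U s" by (metis IntE)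
    have "inj_on b I"
      using b Udisj by (metis disjoint_iff inj_onI)
    moreover have "J = b ` I"
    proof
      show "b ` I \<subseteq> J" using b by auto
      show "J \<subseteq> b ` I"
      proof
        fix y assume y: "y \<in> J"
        then obtain s where s: "s \<in> I" "y \<in> U s" using J by (auto simp: N_def)
        \<comment> \<open>\<open>J\<close> is independent and \<open>C s\<close> is a clique, so they share at most one point\<close>
        have "y \<in> C s" "b s \<in> C s" using s b by (auto simp: U_def)
        moreover have "independent_set X E J" using J by (auto simp: N_def indep_sets_def)
        ultimately have "y = b s"
          using C[OF s(1)] y b[OF s(1)]
          unfolding clique_def independent_set_def pairwise_def by metis
        then show "y \<in> b ` I" using s by auto
      qed
    qed
    moreover have "\<forall>s\<in>I. b s \<in> W s" using b by (auto simp: U_def)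
    ultimately show ?thesis by blast
  qed
  ultimately show ?thesis by blast
qed

text \<open>A converse to the previous lemma: every open neighbourhood of \<open>Q\<close> contains all sufficiently small
  independent perturbations of \<open>Q\<close>. One tuple \<open>v\<close> enumerating \<open>Q\<close> is enough; \<open>V s\<close> intersects the sides of a box
  around \<open>v\<close> over all positions at which \<open>v\<close> takes the value \<open>s\<close>.\<close>

lemma indep_top_perturb:
  assumes W: "openin (indep_top X E m) W" and Q: "Q \<in> W"
  shows "\<exists>V. (\<forall>s\<in>Q. openin X (V s) \<and> s \<in> V s) \<and>
           (\<forall>b. (\<forall>s\<in>Q. b s \<in> V s) \<and> b ` Q \<in> indep_sets X E m \<longrightarrow> b ` Q \<in> W)"
proof (cases "Q = {}")
  case True
  then show ?thesis using Q by auto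
next
  case False
  obtain W' where W': "openin (Sub_top X m) W'" "W = W' \<inter> indep_sets X E m"
    using W by (auto simp: indep_top_def openin_subtopology)
  have Qi: "Q \<in> indep_sets X E m" using W' Q by auto
  then have QS: "Q \<in> Sub (topspace X) m - {{}}" and Qfin: "finite Q"
    using False by (auto simp: indep_sets_def Sub_def)
  then have m: "1 \<le> m" by (cases m) (auto simp: Sub_def)
  have "Q \<in> (\<lambda>v. v ` {..<m}) ` topspace (power_top X m)"
    using quotient_imp_surjective_map[OF quotient_map_Sub_top[OF m, of X]] QS
    by (auto simp: topspace_subtopology)
  then obtain v where v: "v \<in> topspace (power_top X m)" "v ` {..<m} = Q" by auto
  have "openin (power_top X m) {v \<in> topspace (power_top X m). v ` {..<m} \<in> W'}"
    using W'(1) by (simp add: openin_Sub_top)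
  moreover have "v \<in> {v \<in> topspace (power_top X m). v ` {..<m} \<in> W'}"
    using v Q W'(2) by simp
  ultimately have "\<exists>U. finite {i \<in> {..<m}. U i \<noteq> topspace X} \<and> (\<forall>i\<in>{..<m}. openin X (U i)) \<and>
      v \<in> PiE {..<m} U \<and> PiE {..<m} U \<subseteq> {v \<in> topspace (power_top X m). v ` {..<m} \<in> W'}"
    unfolding power_top_def openin_product_topology_alt by (rule bspec)
  then obtain U where U: "\<And>i. i < m \<Longrightarrow> openin X (U i)" "v \<in> PiE {..<m} U"
    "PiE {..<m} U \<subseteq> {v \<in> topspace (power_top X m). v ` {..<m} \<in> W'}"
    by blast
  define V where "V s = (\<Inter>i\<in>{i. i < m \<and> v i = s}. U i) \<inter> topspace X" for s
  have "openin X (V s) \<and> s \<in> V s" if "s \<in> Q" for s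
  proof
    show "openin X (V s)" unfolding V_def using U by (intro openin_INT) auto
    show "s \<in> V s" using U(2) that QS by (auto simp: V_def PiE_iff Sub_def)
  qed
  moreover have "b ` Q \<in> W" if b: "\<forall>s\<in>Q. b s \<in> V s" "b ` Q \<in> indep_sets X E m" for b
  proof -
    have "(\<lambda>i\<in>{..<m}. b (v i)) \<in> PiE {..<m} U"
      using b(1) v(2) by (auto simp: V_def)
    then have "(\<lambda>i\<in>{..<m}. b (v i)) ` {..<m} \<in> W'" using U(3) by blast
    moreover have "(\<lambda>i\<in>{..<m}. b (v i)) ` {..<m} = b ` Q"
      unfolding v(2)[symmetric] by (auto simp: image_iff)
    ultimately show ?thesis using b(2) W'(2) by simp
  qed
  ultimately show ?thesis by blast
qed

text \<open>The cardinality is locally constant on the independent sets, because perturbations are injective.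
  Hence kernels that depend on cardinalities only are continuous.\<close>

lemma openin_indep_sets_card:
  assumes pack: "packing_graph X E"
  shows "openin (indep_top X E k) {I \<in> indep_sets X E k. P (card I)}"
proof (subst openin_subopen, rule ballI)
  fix I assume I: "I \<in> {I \<in> indep_sets X E k. P (card I)}"
  then have "openin X (topspace X) \<and> s \<in> topspace X" if "s \<in> I" for s
    using that by (auto simp: indep_sets_def Sub_def)
  from independent_set_neighbourhood[OF pack _ this] I
  obtain N where N: "openin (indep_top X E k) N" "I \<in> N"
    "\<And>J. J \<in> N \<Longrightarrow> \<exists>b. inj_on b I \<and> J = b ` I"
    unfolding mem_Collect_eq by metis
  have "N \<subseteq> indep_sets X E k" using openin_subset[OF N(1)] by simp
  moreover have "card J = card I" if "J \<in> N" for J using N(3)[OF that] by (auto simp: card_image)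
  ultimately have "N \<subseteq> {I \<in> indep_sets X E k. P (card I)}" using I by auto
  then show "\<exists>T. openin (indep_top X E k) T \<and> I \<in> T \<and> T \<subseteq> {I \<in> indep_sets X E k. P (card I)}"
    using N(1,2) by blast
qed

lemma continuous_map_card:
  assumes "packing_graph X E"
  shows "continuous_map (indep_top X E k) euclideanreal (\<lambda>S. g (card S))"
  unfolding continuous_map_def
  using openin_indep_sets_card[OF assms, of k "\<lambda>n. g n \<in> U" for U] by simp

section \<open>The operator \<open>B_k\<close>\<close>

definition B_index :: "nat \<Rightarrow> 'a set \<Rightarrow> (('a set \<times> 'a set) \<times> 'a set) set" where
  "B_index k I = {((S, T), Q). S \<in> Sub I 1 \<and> T \<in> Sub I 1 \<and> Q \<in> Sub I (k - 2) \<and> Q \<union> S \<union> T = I}"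

lemma finite_Sub: "finite A \<Longrightarrow> finite (Sub A n)"
  by (rule finite_subset[of _ "Pow A"]) (auto simp: Sub_def)

lemma finite_B_index:
  assumes "finite I"
  shows "finite (B_index k I)"
  by (rule finite_subset[of _ "(Sub I 1 \<times> Sub I 1) \<times> Sub I (k - 2)"])
    (auto simp: B_index_def finite_Sub assms)

lemma B_op_eq_sum:
  assumes "finite I"
  shows "B_op k F I = sum F (B_index k I)"
proof -
  let ?P = "\<lambda>Q. {(S, T). S \<in> Sub I 1 \<and> T \<in> Sub I 1 \<and> Q \<union> S \<union> T = I}"
  have fin: "finite (?P Q)" for Q
    by (rule finite_subset[of _ "Sub I 1 \<times> Sub I 1"]) (auto simp: finite_Sub assms)
  have "B_op k F I = (\<Sum>Q\<in>Sub I (k - 2). \<Sum>p\<in>?P Q. F (p, Q))"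
    unfolding B_op_def by (intro sum.cong refl) auto
  also have "\<dots> = (\<Sum>(Q, p)\<in>Sigma (Sub I (k - 2)) ?P. F (p, Q))"
    by (rule sum.Sigma) (use fin assms finite_Sub in auto)
  also have "\<dots> = sum F (B_index k I)"
    by (rule sum.reindex_bij_witness[of _ "\<lambda>(p, Q). (Q, p)" "\<lambda>(Q, p). (p, Q)"])
      (auto simp: B_index_def)
  finally show ?thesis .
qed

text \<open>Every triple \<open>(S, T, Q)\<close> of subsets of \<open>W\<close> is counted once, in the summand of the union
  \<open>Q \<union> S \<union> T\<close>, whose size is at most \<open>k\<close>. This identity drives both bounds on the \<open>k\<close>-point bound.\<close>

lemma sum_B_op:
  assumes W: "finite W" and k: "2 \<le> k"
  shows "(\<Sum>I\<in>Sub W k. B_op k F I) = sum F ((Sub W 1 \<times> Sub W 1) \<times> Sub W (k - 2))"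
proof -
  let ?P = "(Sub W 1 \<times> Sub W 1) \<times> Sub W (k - 2)"
  let ?g = "\<lambda>((S, T), Q). Q \<union> S \<union> T"
  have "B_op k F I = sum F {x \<in> ?P. ?g x = I}" if I: "I \<in> Sub W k" for I
  proof -
    have "finite I" using I by (auto simp: Sub_def)
    moreover have "B_index k I = {x \<in> ?P. ?g x = I}"
      using I by (auto simp: B_index_def Sub_def)
    ultimately show ?thesis by (simp add: B_op_eq_sum)
  qed
  then have "(\<Sum>I\<in>Sub W k. B_op k F I) = (\<Sum>I\<in>Sub W k. sum F {x \<in> ?P. ?g x = I})"
    by (intro sum.cong refl) auto
  also have "\<dots> = sum F ?P"
  proof (rule sum.group)
    show "?g ` ?P \<subseteq> Sub W k"
    proof (clarsimp simp: Sub_def)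
      fix S T Q :: "'a set"
      assume "card S \<le> Suc 0" "card T \<le> Suc 0" "card Q \<le> k - 2"
      then show "card (Q \<union> S \<union> T) \<le> k"
        using card_Un_le[of "Q \<union> S" T] card_Un_le[of Q S] k by linarith
    qed
  qed (use W finite_Sub in auto)
  finally show ?thesis .
qed

lemma B_op_image:
  assumes I: "finite I" and b: "inj_on b I"
  shows "B_op k F (b ` I) = (\<Sum>((S, T), Q)\<in>B_index k I. F ((b ` S, b ` T), b ` Q))"
proof -
  let ?h = "\<lambda>((S, T), Q). ((b ` S, b ` T), b ` Q)"
  have inj: "inj_on ?h (B_index k I)"
  proof (rule inj_onI)
    fix x y assume xy: "x \<in> B_index k I" "y \<in> B_index k I" "?h x = ?h y"
    obtain S T Q S' T' Q' where e: "x = ((S, T), Q)" "y = ((S', T'), Q')" by (metis surj_pair)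
    have "S \<subseteq> I" "T \<subseteq> I" "Q \<subseteq> I" "S' \<subseteq> I" "T' \<subseteq> I" "Q' \<subseteq> I"
      using xy(1,2) by (auto simp: e B_index_def)
    then show "x = y"
      using xy(3) inj_on_image_eq_iff[OF b] by (simp add: e)
  qed
  have "B_index k (b ` I) = ?h ` B_index k I"
  proof (intro equalityI subsetI)
    fix x assume "x \<in> B_index k (b ` I)"
    then obtain S T Q where x: "x = ((S, T), Q)" "S \<in> Sub (b ` I) 1" "T \<in> Sub (b ` I) 1"
      "Q \<in> Sub (b ` I) (k - 2)" "Q \<union> S \<union> T = b ` I"
      by (auto simp: B_index_def)
    have pull: "\<exists>A'\<in>Sub I n. A = b ` A'" if A: "A \<in> Sub (b ` I) n" for A n
    proof -
      obtain A' where A': "A' \<subseteq> I" "A = b ` A'"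
        using A by (auto simp: Sub_def subset_image_iff)
      have "card A' = card A" using A' card_image[OF inj_on_subset[OF b A'(1)]] by simp
      then have "A' \<in> Sub I n" using A A' I by (auto simp: Sub_def intro: finite_subset)
      with A' show ?thesis by blast
    qed
    obtain S' T' Q' where p: "S' \<in> Sub I 1" "T' \<in> Sub I 1" "Q' \<in> Sub I (k - 2)"
      "S = b ` S'" "T = b ` T'" "Q = b ` Q'"
      using pull x by metis
    have "b ` (Q' \<union> S' \<union> T') = b ` I" using x p by (simp add: image_Un)
    then have "Q' \<union> S' \<union> T' = I"
      using p by (subst (asm) inj_on_image_eq_iff[OF b]) (auto simp: Sub_def)
    then have "((S', T'), Q') \<in> B_index k I" using p by (simp add: B_index_def)
    from imageI[OF this, of ?h] show "x \<in> ?h ` B_index k I" using p x by simp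
  next
    fix x assume "x \<in> ?h ` B_index k I"
    then obtain S T Q where x: "x = ((b ` S, b ` T), b ` Q)" "S \<in> Sub I 1" "T \<in> Sub I 1"
      "Q \<in> Sub I (k - 2)" "Q \<union> S \<union> T = I"
      unfolding B_index_def by fast
    have push: "b ` A \<in> Sub (b ` I) n" if "A \<in> Sub I n" for A n
      using that card_image_le[of A b] by (auto simp: Sub_def)
    have "b ` Q \<union> b ` S \<union> b ` T = b ` I" using x by (simp flip: image_Un)
    then show "x \<in> B_index k (b ` I)" using x push by (simp add: B_index_def)
  qed
  then have "B_op k F (b ` I) = sum F (?h ` B_index k I)"
    using I by (simp add: B_op_eq_sum)
  also have "\<dots> = (\<Sum>x\<in>B_index k I. F (?h x))"
    using inj by (simp add: sum.reindex)
  finally show ?thesis by (simp add: case_prod_unfold)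
qed

lemma indep_sets_subset:
  assumes "I \<in> indep_sets X E k" "S \<in> Sub I m"
  shows "S \<in> indep_sets X E m"
proof -
  have "S \<subseteq> topspace X" using assms by (auto simp: indep_sets_def Sub_def)
  moreover have "pairwise (\<lambda>x y. (x, y) \<notin> E) S"
    using assms by (auto simp: indep_sets_def Sub_def independent_set_def intro: pairwise_subset)
  ultimately show ?thesis
    using assms by (auto simp: indep_sets_def Sub_def independent_set_def)
qed

lemma triple_top_perturb:
  assumes F: "F \<in> C_space (triple_top X E k)" and I: "I \<in> indep_sets X E k"
    and x: "((S, T), Q) \<in> B_index k I" and e: "0 < (e::real)"
  shows "\<exists>V. (\<forall>s\<in>I. openin X (V s) \<and> s \<in> V s) \<and>
           (\<forall>b. (\<forall>s\<in>I. b s \<in> V s) \<and> b ` I \<in> indep_sets X E k \<longrightarrow>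
              \<bar>F ((b ` S, b ` T), b ` Q) - F ((S, T), Q)\<bar> < e)"
proof -
  let ?c = "F ((S, T), Q)"
  have sub: "S \<in> Sub I 1" "T \<in> Sub I 1" "Q \<in> Sub I (k - 2)"
    using x by (auto simp: B_index_def)
  then have ind: "S \<in> indep_sets X E 1" "T \<in> indep_sets X E 1" "Q \<in> indep_sets X E (k - 2)"
    using indep_sets_subset[OF I] by blast+
  let ?O = "{y \<in> topspace (triple_top X E k). F y \<in> ball ?c e}"
  have "openin (triple_top X E k) ?O"
    using F by (intro openin_continuous_map_preimage) (auto simp: C_space_def)
  then have O: "openin (prod_topology (prod_topology (indep_top X E 1) (indep_top X E 1))
      (indep_top X E (k - 2))) ?O"
    by (simp only: triple_top_def)
  have inO: "((S, T), Q) \<in> ?O" using ind e by (simp add: triple_top_def)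
  obtain A C where A: "openin (prod_topology (indep_top X E 1) (indep_top X E 1)) A"
      "(S, T) \<in> A" and C: "openin (indep_top X E (k - 2)) C" "Q \<in> C" and AC: "A \<times> C \<subseteq> ?O"
    using openin_prod_topology_alt[THEN iffD1, rule_format, OF O inO] by blast
  obtain A1 A2 where op: "openin (indep_top X E 1) A1" "openin (indep_top X E 1) A2"
      "S \<in> A1" "T \<in> A2" and A12: "A1 \<times> A2 \<subseteq> A"
    using openin_prod_topology_alt[THEN iffD1, rule_format, OF A] by blast
  have box: "(A1 \<times> A2) \<times> C \<subseteq> ?O" using AC A12 by blast
  from indep_top_perturb[OF op(1,3)] obtain V1 where V1: "\<And>s. s \<in> S \<Longrightarrow> openin X (V1 s) \<and> s \<in> V1 s"
    "\<And>b. (\<forall>s\<in>S. b s \<in> V1 s) \<Longrightarrow> b ` S \<in> indep_sets X E 1 \<Longrightarrow> b ` S \<in> A1" by blast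
  from indep_top_perturb[OF op(2,4)] obtain V2 where V2: "\<And>s. s \<in> T \<Longrightarrow> openin X (V2 s) \<and> s \<in> V2 s"
    "\<And>b. (\<forall>s\<in>T. b s \<in> V2 s) \<Longrightarrow> b ` T \<in> indep_sets X E 1 \<Longrightarrow> b ` T \<in> A2" by blast
  from indep_top_perturb[OF C] obtain V3 where V3: "\<And>s. s \<in> Q \<Longrightarrow> openin X (V3 s) \<and> s \<in> V3 s"
    "\<And>b. (\<forall>s\<in>Q. b s \<in> V3 s) \<Longrightarrow> b ` Q \<in> indep_sets X E (k - 2) \<Longrightarrow> b ` Q \<in> C" by blast
  define V where "V s = (if s \<in> S then V1 s else topspace X) \<inter> (if s \<in> T then V2 s else topspace X)
    \<inter> (if s \<in> Q then V3 s else topspace X)" for s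
  have Isub: "I \<subseteq> topspace X" using I by (auto simp: indep_sets_def Sub_def)
  have "openin X (V s) \<and> s \<in> V s" if "s \<in> I" for s
    unfolding V_def using that Isub V1(1) V2(1) V3(1) by (intro conjI openin_Int IntI) auto
  moreover have "\<bar>F ((b ` S, b ` T), b ` Q) - ?c\<bar> < e"
    if b: "\<forall>s\<in>I. b s \<in> V s" "b ` I \<in> indep_sets X E k" for b
  proof -
    have push: "b ` A \<in> indep_sets X E n" if "A \<in> Sub I n" for A n
      using that card_image_le[of A b] by (intro indep_sets_subset[OF b(2)]) (auto simp: Sub_def)
    have b': "b s \<in> V s" if "s \<in> S \<union> T \<union> Q" for s
      using that b(1) sub by (auto simp: Sub_def)
    have "b s \<in> V1 s" if "s \<in> S" for s using b'[of s] that by (simp add: V_def)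
    moreover have "b s \<in> V2 s" if "s \<in> T" for s using b'[of s] that by (simp add: V_def)
    moreover have "b s \<in> V3 s" if "s \<in> Q" for s using b'[of s] that by (simp add: V_def)
    ultimately have bV: "\<forall>s\<in>S. b s \<in> V1 s" "\<forall>s\<in>T. b s \<in> V2 s" "\<forall>s\<in>Q. b s \<in> V3 s"
      by simp_all
    have "b ` S \<in> A1" by (rule V1(2)[OF bV(1) push[OF sub(1)]])
    moreover have "b ` T \<in> A2" by (rule V2(2)[OF bV(2) push[OF sub(2)]])
    moreover have "b ` Q \<in> C" by (rule V3(2)[OF bV(3) push[OF sub(3)]])
    ultimately have "((b ` S, b ` T), b ` Q) \<in> ?O" using box by blast
    then show ?thesis by (simp add: dist_real_def abs_minus_commute)
  qed
  ultimately show ?thesis by blast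
qed

text \<open>By the description of neighbourhoods, a set close to \<open>I\<close> is \<open>b ` I\<close> for an injective small
  perturbation \<open>b\<close>. The summands of \<open>B_k F\<close> at \<open>b ` I\<close> are the perturbed summands at \<open>I\<close>, so the
  continuity of \<open>F\<close> at the finitely many triples of \<open>I\<close> gives the continuity of \<open>B_k F\<close> at \<open>I\<close>.\<close>

lemma B_op_continuous:
  assumes pack: "packing_graph X E" and F: "F \<in> C_space (triple_top X E k)"
  shows "B_op k F \<in> C_space (indep_top X E k)"
proof -
  have local: "\<exists>N. openin (indep_top X E k) N \<and> I \<in> N \<and> (\<forall>J\<in>N. \<bar>B_op k F J - B_op k F I\<bar> < e)"
    if I: "I \<in> indep_sets X E k" and e: "0 < e" for I and e :: real
  proof -
    let ?B = "B_index k I"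
    have finI: "finite I" and finB: "finite ?B"
      using finite_indep_sets[OF I] finite_B_index[OF finite_indep_sets[OF I]] by blast+
    define d where "d = e / (real (card ?B) + 1)"
    have d: "0 < d" "real (card ?B) * d < e"
      using e by (auto simp: d_def field_simps)
    let ?h = "\<lambda>b ((S, T), Q). ((b ` S, b ` T), b ` Q)"
    have "\<forall>x\<in>?B. \<exists>V. (\<forall>s\<in>I. openin X (V s) \<and> s \<in> V s) \<and>
        (\<forall>b. (\<forall>s\<in>I. b s \<in> V s) \<and> b ` I \<in> indep_sets X E k \<longrightarrow> \<bar>F (?h b x) - F x\<bar> < d)"
      using triple_top_perturb[OF F I _ d(1)] by force
    then obtain V where V: "\<And>x s. x \<in> ?B \<Longrightarrow> s \<in> I \<Longrightarrow> openin X (V x s) \<and> s \<in> V x s"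
      "\<And>x b. x \<in> ?B \<Longrightarrow> \<forall>s\<in>I. b s \<in> V x s \<Longrightarrow> b ` I \<in> indep_sets X E k \<Longrightarrow> \<bar>F (?h b x) - F x\<bar> < d"
      by metis
    let ?W = "\<lambda>s. (\<Inter>x\<in>?B. V x s) \<inter> topspace X"
    have "openin X (?W s) \<and> s \<in> ?W s" if "s \<in> I" for s
    proof
      show "openin X (?W s)" using V(1) that finB by (intro openin_INT) auto
      show "s \<in> ?W s" using V(1) that I by (auto simp: indep_sets_def Sub_def)
    qed
    from independent_set_neighbourhood[OF pack I this] obtain N where
      N: "openin (indep_top X E k) N" "I \<in> N"
      "\<And>J. J \<in> N \<Longrightarrow> \<exists>b. inj_on b I \<and> J = b ` I \<and> (\<forall>s\<in>I. b s \<in> ?W s)"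
      by metis
    have "\<bar>B_op k F J - B_op k F I\<bar> < e" if J: "J \<in> N" for J
    proof -
      obtain b where b: "inj_on b I" "J = b ` I" "\<forall>s\<in>I. b s \<in> ?W s" using N(3)[OF J] by blast
      have "b ` I \<in> indep_sets X E k" using J b openin_subset[OF N(1)] by auto
      then have close: "\<bar>F (?h b x) - F x\<bar> \<le> d" if "x \<in> ?B" for x
        using V(2)[OF that, of b] b(3) that by fastforce
      have "B_op k F J - B_op k F I = (\<Sum>x\<in>?B. F (?h b x) - F x)"
        unfolding b(2) B_op_image[OF finI b(1)] B_op_eq_sum[OF finI]
        by (simp add: sum_subtractf case_prod_unfold)
      also have "\<bar>\<dots>\<bar> \<le> (\<Sum>x\<in>?B. \<bar>F (?h b x) - F x\<bar>)" by (rule sum_abs)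
      also have "\<dots> \<le> real (card ?B) * d" by (rule sum_bounded_above) (rule close)
      finally show ?thesis using d(2) by linarith
    qed
    then show ?thesis using N(1,2) by blast
  qed
  have "openin (indep_top X E k) {I \<in> indep_sets X E k. B_op k F I \<in> U}" if U: "open U" for U
  proof (subst openin_subopen, rule ballI)
    fix I assume I: "I \<in> {I \<in> indep_sets X E k. B_op k F I \<in> U}"
    then obtain e where e: "0 < e" "ball (B_op k F I) e \<subseteq> U"
      using U open_contains_ball by blast
    obtain N where N: "openin (indep_top X E k) N" "I \<in> N"
      "\<And>J. J \<in> N \<Longrightarrow> \<bar>B_op k F J - B_op k F I\<bar> < e"
      using local[of I e] I e by blast
    have "N \<subseteq> {I \<in> indep_sets X E k. B_op k F I \<in> U}"
    proof
      fix J assume J: "J \<in> N"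
      have "B_op k F J \<in> ball (B_op k F I) e"
        using N(3)[OF J] by (simp add: dist_real_def abs_minus_commute)
      then show "J \<in> {I \<in> indep_sets X E k. B_op k F I \<in> U}"
        using e(2) J openin_subset[OF N(1)] by auto
    qed
    then show "\<exists>T. openin (indep_top X E k) T \<and> I \<in> T \<and>
        T \<subseteq> {I \<in> indep_sets X E k. B_op k F I \<in> U}"
      using N(1,2) by blast
  qed
  then show ?thesis by (simp add: C_space_def continuous_map_def)
qed

section \<open>The \<open>k\<close>-point bound is at least the independence number\<close>

lemma Sub_in_indep_sets:
  assumes "independent_set X E W" "S \<in> Sub W m"
  shows "S \<in> indep_sets X E m"
proof -
  have "S \<subseteq> W" "finite S" using assms(2) by (auto simp: Sub_def)
  then have "S \<in> indep_sets X E (card S)"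
    using assms(1) by (auto simp: indep_sets_def Sub_def independent_set_def intro: pairwise_subset)
  moreover have "S \<in> Sub S m" using assms(2) by (auto simp: Sub_def)
  ultimately show ?thesis by (rule indep_sets_subset)
qed

text \<open>The feasible measure has an atom of mass 1 at each subset of \<open>W\<close> with at most \<open>k\<close> elements. By
  \<open>sum_B_op\<close>, its image under the adjoint of \<open>B_k\<close> has an atom of mass 1 at each triple of subsets of
  \<open>W\<close>; for each \<open>Q\<close> this pairs a psd kernel with the all-ones matrix.\<close>

lemma Delta_ge_card_independent:
  assumes G: "compact_packing_graph X E" and W: "independent_set X E W" "finite W" and k: "2 \<le> k"
  shows "ereal (real (card W)) \<le> Delta X E k"
proof -
  let ?Y = "indep_top X E k" and ?Z = "triple_top X E k"
  let ?K = "(Sub W 1 \<times> Sub W 1) \<times> Sub W (k - 2)"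
  have pack: "packing_graph X E" using G by (simp add: compact_packing_graph_def)
  interpret \<nu>: finite_atoms ?Y "Sub W k" "\<lambda>_. 1" "\<lambda>I. I"
    by unfold_locales (auto simp: finite_Sub W Sub_in_indep_sets[OF W(1)])
  interpret \<mu>: finite_atoms ?Z ?K "\<lambda>_. 1" "\<lambda>x. x"
    by unfold_locales (auto simp: finite_Sub W triple_top_def Sub_in_indep_sets[OF W(1)])
  let ?\<nu> = "measure \<nu>.\<rho>" and ?\<mu> = "measure \<mu>.\<rho>"
  note Y = indep_top_compact_t1[OF G, of k] and Z = triple_top_compact_t1[OF G, of k]
  have \<mu>_pair: "pairing ?Z F ?\<mu> = sum F ?K" if "F \<in> C_space ?Z" for F
    using \<mu>.pairing_atomic[OF Z(2,1) that] by simp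
  have adj: "is_adjoint_image ?Z ?Y (C_sym_triple X E k) (B_op k) ?\<nu> ?\<mu>"
    unfolding is_adjoint_image_def
  proof
    fix F assume "F \<in> C_sym_triple X E k"
    then have F: "F \<in> C_space ?Z" by (simp add: C_sym_triple_def)
    have "pairing ?Y (B_op k F) ?\<nu> = (\<Sum>I\<in>Sub W k. B_op k F I)"
      using \<nu>.pairing_atomic[OF Y(2,1) B_op_continuous[OF pack F]] by simp
    then show "pairing ?Z F ?\<mu> = pairing ?Y (B_op k F) ?\<nu>"
      using \<mu>_pair[OF F] sum_B_op[OF W(2) k] by simp
  qed
  have "?\<mu> \<in> M_psd X E k"
  proof -
    have "invariant_under ?Z (\<lambda>((S, T), Q). ((T, S), Q)) ?\<mu>"
    proof (rule \<mu>.atomic_invariant[where \<tau> = "\<lambda>((S, T), Q). ((T, S), Q)"])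
      have "continuous_map ?Z (indep_top X E 1) (fst \<circ> fst)"
        "continuous_map ?Z (indep_top X E 1) (snd \<circ> fst)" "continuous_map ?Z (indep_top X E (k - 2)) snd"
        unfolding triple_top_def
        by (rule continuous_map_compose continuous_map_fst continuous_map_snd)+
      then have "continuous_map ?Z ?Z (\<lambda>x. ((snd (fst x), fst (fst x)), snd x))"
        by (simp add: triple_top_def continuous_map_pairwise o_def)
      then show "continuous_map ?Z ?Z (\<lambda>((S, T), Q). ((T, S), Q))"
        by (simp add: case_prod_unfold)
      show "bij_betw (\<lambda>((S, T), Q). ((T, S), Q)) ?K ?K"
        by (rule bij_betwI[where g = "\<lambda>((S, T), Q). ((T, S), Q)"]) auto
    qed auto
    then have "?\<mu> \<in> M_sym_triple X E k"
      using \<mu>.atomic_in_M_nonneg[OF Z(2)] by (simp add: M_sym_triple_def M_nonneg_def)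
    moreover have "0 \<le> pairing ?Z F ?\<mu>" if F: "F \<in> C_psd X E k" for F
    proof -
      have "pairing ?Z F ?\<mu> = sum F ?K"
        using F by (intro \<mu>_pair) (simp add: C_psd_def C_sym_triple_def)
      also have "\<dots> = (\<Sum>p\<in>Sub W 1 \<times> Sub W 1. \<Sum>Q\<in>Sub W (k - 2). F (p, Q))"
        by (simp add: sum.cartesian_product)
      also have "\<dots> = (\<Sum>Q\<in>Sub W (k - 2). \<Sum>p\<in>Sub W 1 \<times> Sub W 1. F (p, Q))"
        by (rule sum.swap)
      also have "\<dots> = (\<Sum>Q\<in>Sub W (k - 2). \<Sum>S\<in>Sub W 1. \<Sum>T\<in>Sub W 1. F ((S, T), Q))"
        by (simp add: sum.cartesian_product case_prod_beta)
      also have "0 \<le> \<dots>"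
      proof (rule sum_nonneg)
        fix Q assume "Q \<in> Sub W (k - 2)"
        then have "psd_kernel_on (indep_sets X E 1) (\<lambda>S T. F ((S, T), Q))"
          using F Sub_in_indep_sets[OF W(1)] by (auto simp: C_psd_def)
        then have "\<And>c. 0 \<le> (\<Sum>S\<in>Sub W 1. \<Sum>T\<in>Sub W 1. c S * c T * F ((S, T), Q))"
          using Sub_in_indep_sets[OF W(1), of _ 1] finite_Sub[OF W(2)]
          unfolding psd_kernel_on_def by blast
        from this[of "\<lambda>_. 1"] show "0 \<le> (\<Sum>S\<in>Sub W 1. \<Sum>T\<in>Sub W 1. F ((S, T), Q))" by simp
      qed
      finally show ?thesis .
    qed
    ultimately show ?thesis by (simp add: M_psd_def)
  qed
  have eq1: "indep_sets_eq X E 1 = {I \<in> indep_sets X E k. card I = 1}"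
    using k by (auto simp: indep_sets_eq_def indep_sets_def Sub_def)
  have eq0: "{{}} = {I \<in> indep_sets X E k. card I = 0}"
    by (auto simp: indep_sets_def Sub_def independent_set_def)
  have meas: "{I \<in> indep_sets X E k. card I = j} \<in> sets (borel_of ?Y)" for j
    using openin_indep_sets_card[OF pack, of k "\<lambda>n. n = j"] by (rule openin_in_borel_of)
  have "?\<nu> {{}} = (\<Sum>I\<in>Sub W k. indicator {{}} I)"
    using meas[of 0] by (simp add: \<nu>.measure_atomic eq0)
  also have "\<dots> = (\<Sum>I\<in>{{} :: 'a set}. 1)"
    by (rule sum.mono_neutral_cong_right) (auto simp: finite_Sub W Sub_def)
  finally have "?\<nu> {{}} = 1" by simp
  with adj \<open>?\<mu> \<in> M_psd X E k\<close> have "?\<nu> \<in> Delta_feasible X E k"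
    using \<nu>.atomic_in_M_nonneg[OF Y(2)] by (auto simp: Delta_feasible_def)
  then have "ereal (?\<nu> (indep_sets_eq X E 1)) \<le> Delta X E k"
    unfolding Delta_def by (rule SUP_upper)
  moreover have "?\<nu> (indep_sets_eq X E 1) = real (card W)"
  proof -
    have "?\<nu> (indep_sets_eq X E 1) = (\<Sum>I\<in>Sub W k. indicator (indep_sets_eq X E 1) I)"
      unfolding eq1 by (simp only: \<nu>.measure_atomic[OF meas] mult_1)
    also have "\<dots> = (\<Sum>I\<in>(\<lambda>x. {x}) ` W. 1)"
    proof (rule sum.mono_neutral_cong_right)
      show "(\<lambda>x. {x}) ` W \<subseteq> Sub W k" using k by (auto simp: Sub_def)
      show "\<forall>I\<in>Sub W k - (\<lambda>x. {x}) ` W. indicator (indep_sets_eq X E 1) I = (0::real)"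
        by (auto simp: indicator_def indep_sets_eq_def Sub_def card_1_singleton_iff)
      show "indicator (indep_sets_eq X E 1) I = (1::real)" if "I \<in> (\<lambda>x. {x}) ` W" for I
        using that W(1) by (auto simp: indicator_def indep_sets_eq_def indep_sets_def Sub_def
            independent_set_def pairwise_def)
    qed (simp add: finite_Sub W)
    also have "\<dots> = real (card W)" by (simp add: card_image)
    finally show ?thesis .
  qed
  ultimately show ?thesis by simp
qed

section \<open>The \<open>k\<close>-point bound is at most the independence number\<close>

text \<open>The coefficient of $\binom{w}{q}$ in the Newton interpolation of $w \mapsto 1/(a-w)$ on
  $0, \dots, a-1$, that is, the \<open>q\<close>-th forward difference at 0. It is nonnegative because it equals the
  Beta integral $\int_0^1 t^{a-1-q}(1-t)^q\,dt$, as $1/(a-w) = \int_0^1 t^{a-1-w}\,dt$.\<close>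

definition newton_coeff :: "nat \<Rightarrow> nat \<Rightarrow> real" where
  "newton_coeff a q = (if q < a then 1 / (real (a - q) * real (a choose q)) else 0)"

lemma newton_coeff_nonneg: "0 \<le> newton_coeff a q"
  by (simp add: newton_coeff_def)

text \<open>Rewriting each summand over the common denominator $(a-w)\binom{a}{w}$ leaves a diagonal sum of
  binomial coefficients equal to $\binom{a}{w}$.\<close>

lemma sum_binomial_newton_coeff:
  assumes "w < a"
  shows "(\<Sum>q\<le>w. real (w choose q) * newton_coeff a q) = 1 / real (a - w)"
proof -
  have summand: "real (w choose q) * newton_coeff a q =
      real ((a - 1 - q) choose (w - q)) / (real (a - w) * real (a choose w))" if q: "q \<le> w" for q
  proof -
    have aw: "a - q - (w - q) = a - w" using q assms by simp
    have "(a choose w) * (w choose q) = (a choose q) * ((a - q) choose (w - q))"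
      using q assms by (intro choose_mult) auto
    moreover have "(a - w) * ((a - q) choose (w - q)) = (a - q) * ((a - 1 - q) choose (w - q))"
      using binomial_absorb_comp[of "a - q" "w - q"] aw by (simp add: diff_commute)
    ultimately have "(a - w) * ((a choose w) * (w choose q)) =
        (a choose q) * ((a - q) * ((a - 1 - q) choose (w - q)))"
      by (metis mult.left_commute)
    then have "real (a - w) * (real (a choose w) * real (w choose q)) =
        real (a choose q) * (real (a - q) * real ((a - 1 - q) choose (w - q)))"
      by (metis of_nat_mult)
    moreover have "real (a choose q) > 0" "real (a choose w) > 0" "real (a - q) > 0" "real (a - w) > 0"
      using q assms by simp_all
    ultimately show ?thesis
      using q assms by (simp add: newton_coeff_def divide_simps mult_ac)
  qed
  have "(\<Sum>q\<le>w. real (w choose q) * newton_coeff a q) =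
      real (\<Sum>q\<le>w. (a - 1 - q) choose (w - q)) / (real (a - w) * real (a choose w))"
    by (simp add: summand sum_divide_distrib)
  also have "(\<Sum>q\<le>w. (a - 1 - q) choose (w - q)) = a choose w"
    using sum_choose_diagonal[of w "a - 1"] assms by simp
  also have "real (a choose w) / (real (a - w) * real (a choose w)) = 1 / real (a - w)"
    using assms by simp
  finally show ?thesis .
qed

lemma sum_over_subsets_by_card:
  fixes g :: "nat \<Rightarrow> real"
  assumes "finite W"
  shows "(\<Sum>Q\<in>Pow W. g (card Q)) = (\<Sum>q\<le>card W. real (card W choose q) * g q)"
proof -
  have "(\<Sum>Q\<in>Pow W. g (card Q)) = (\<Sum>q\<le>card W. \<Sum>Q\<in>{Q \<in> Pow W. card Q = q}. g (card Q))"
    by (rule sum.group[symmetric]) (use assms in \<open>auto intro: card_mono\<close>)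
  also have "\<dots> = (\<Sum>q\<le>card W. real (card W choose q) * g q)"
    using n_subsets[OF assms] by (intro sum.cong refl) simp
  finally show ?thesis .
qed

text \<open>Moebius inversion on the subset lattice, in the form of a uniqueness statement.\<close>

lemma eq_if_subset_sums_eq:
  fixes g h :: "'a set \<Rightarrow> real"
  assumes "finite W" and "\<And>V. V \<subseteq> W \<Longrightarrow> (\<Sum>I\<in>Pow V. g I) = (\<Sum>I\<in>Pow V. h I)"
  shows "g W = h W"
  using assms
proof (induction W rule: finite_psubset_induct)
  case (psubset W)
  have split: "(\<Sum>I\<in>Pow W. f I) = f W + (\<Sum>I\<in>Pow W - {W}. f I)" for f :: "'a set \<Rightarrow> real"
    using psubset.hyps by (intro sum.remove) auto
  have "g I = h I" if "I \<in> Pow W - {W}" for I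
    by (rule psubset.IH) (use that in blast, rule psubset.prems, use that in blast)
  then have "(\<Sum>I\<in>Pow W - {W}. g I) = (\<Sum>I\<in>Pow W - {W}. h I)"
    by (rule sum.cong[OF refl])
  then show ?case using psubset.prems[of W] split[of g] split[of h] by simp
qed

text \<open>The vector with entry \<open>a\<close> at the empty set and -1 at each singleton. Its sum over the subsets of
  \<open>W\<close> with at most one element is the slack \<open>a - card W\<close>.\<close>

definition slack :: "nat \<Rightarrow> nat \<Rightarrow> real" where
  "slack a n = (if n = 0 then real a else - 1)"

text \<open>For each \<open>Q\<close> a nonnegative multiple of the rank-one kernel given by the vector \<open>slack a\<close>.\<close>

definition slack_kernel :: "nat \<Rightarrow> ('a set \<times> 'a set) \<times> 'a set \<Rightarrow> real" where
  "slack_kernel a = (\<lambda>((S, T), Q). newton_coeff a (card Q) * (slack a (card S) * slack a (card T)))"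

lemma sum_slack:
  assumes "finite W"
  shows "(\<Sum>S\<in>Sub W 1. slack a (card S)) = real a - real (card W)"
proof -
  have "Sub W 1 = insert {} ((\<lambda>x. {x}) ` W)"
  proof (intro equalityI subsetI)
    fix S assume "S \<in> Sub W 1"
    then have S: "S \<subseteq> W" "finite S" "card S \<le> 1" by (auto simp: Sub_def)
    then have "card S = 0 \<or> card S = 1" by linarith
    then consider "S = {}" | x where "S = {x}" using S(2) by (auto simp: card_1_singleton_iff)
    then show "S \<in> insert {} ((\<lambda>x. {x}) ` W)" using S(1) by cases auto
  qed (auto simp: Sub_def)
  moreover have "(\<Sum>S\<in>(\<lambda>x. {x}) ` W. slack a (card S)) = - real (card W)"
    by (simp add: sum.reindex slack_def)
  moreover have "{} \<notin> (\<lambda>x. {x}) ` W" by auto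
  ultimately show ?thesis using assms by (simp add: slack_def)
qed

text \<open>The sum is $(a-|W|)^2 \sum_q \binom{|W|}{q} c_q$ with the Newton coefficients \<open>c\<close> of $1/(a-w)$,
  and one factor cancels. For $|W| = a$ the interpolation says nothing, but both sides vanish. The
  coefficients vanish for \<open>q \<ge> a\<close>, so the bound \<open>k - 2 \<ge> a - 1\<close> on the size of \<open>Q\<close> loses nothing.\<close>

lemma sum_slack_kernel:
  assumes W: "finite W" "card W \<le> a" and k: "a + 1 \<le> k" "2 \<le> k"
  shows "sum (slack_kernel a) ((Sub W 1 \<times> Sub W 1) \<times> Sub W (k - 2)) = real a - real (card W)"
proof -
  have "sum (slack_kernel a) ((Sub W 1 \<times> Sub W 1) \<times> Sub W (k - 2)) =
      (\<Sum>p\<in>Sub W 1 \<times> Sub W 1. slack a (card (fst p)) * slack a (card (snd p))) *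
      (\<Sum>Q\<in>Sub W (k - 2). newton_coeff a (card Q))"
    unfolding sum_product sum.cartesian_product
    by (intro sum.cong refl) (simp add: slack_kernel_def case_prod_unfold mult_ac)
  also have "(\<Sum>p\<in>Sub W 1 \<times> Sub W 1. slack a (card (fst p)) * slack a (card (snd p))) =
      (real a - real (card W)) * (real a - real (card W))"
    unfolding sum_slack[OF W(1), symmetric]
    by (simp only: sum_product sum.cartesian_product case_prod_unfold)
  also have "(\<Sum>Q\<in>Sub W (k - 2). newton_coeff a (card Q)) = (\<Sum>Q\<in>Pow W. newton_coeff a (card Q))"
  proof (rule sum.mono_neutral_left)
    show "Sub W (k - 2) \<subseteq> Pow W" by (auto simp: Sub_def)
    show "\<forall>Q\<in>Pow W - Sub W (k - 2). newton_coeff a (card Q) = 0"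
      using W(1) k by (auto simp: Sub_def newton_coeff_def intro: finite_subset)
  qed (use W in auto)
  also have "\<dots> = (\<Sum>q\<le>card W. real (card W choose q) * newton_coeff a q)"
    by (rule sum_over_subsets_by_card[OF W(1)])
  also have "(real a - real (card W)) * (real a - real (card W)) * \<dots> = real a - real (card W)"
  proof (cases "card W < a")
    case True
    then show ?thesis by (simp add: sum_binomial_newton_coeff of_nat_diff)
  qed (use W in simp)
  finally show ?thesis .
qed

text \<open>Both sides have the same sum over the subsets of every \<open>V \<subseteq> I\<close>, namely \<open>a - card V\<close>.\<close>

lemma B_op_slack_kernel:
  assumes I: "finite I" "card I \<le> a" and k: "a + 1 \<le> k" "2 \<le> k"
  shows "B_op k (slack_kernel a) I = (if card I \<le> 1 then slack a (card I) else 0)"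
proof (rule eq_if_subset_sums_eq[OF I(1)])
  fix V assume "V \<subseteq> I"
  then have V: "finite V" "card V \<le> a"
    using I finite_subset card_mono[of I V] by auto
  have Sub_Pow: "Sub V k = Pow V"
  proof
    show "Pow V \<subseteq> Sub V k"
    proof
      fix U assume "U \<in> Pow V"
      then have "U \<subseteq> V" "finite U" "card U \<le> card V"
        using V(1) finite_subset card_mono by auto
      then show "U \<in> Sub V k" using V(2) k(1) by (simp add: Sub_def)
    qed
  qed (auto simp: Sub_def)
  have "(\<Sum>J\<in>Pow V. B_op k (slack_kernel a) J) = real a - real (card V)"
    using sum_B_op[OF V(1) k(2), of "slack_kernel a"] sum_slack_kernel[OF V k]
    unfolding Sub_Pow by simp
  also have "\<dots> = (\<Sum>J\<in>Sub V 1. slack a (card J))"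
    by (simp only: sum_slack[OF V(1)])
  also have "\<dots> = (\<Sum>J\<in>Pow V. if card J \<le> 1 then slack a (card J) else 0)"
    using V(1) by (intro sum.mono_neutral_cong_left) (auto simp: Sub_def intro: finite_subset)
  finally show "(\<Sum>J\<in>Pow V. B_op k (slack_kernel a) J) =
      (\<Sum>J\<in>Pow V. if card J \<le> 1 then slack a (card J) else 0)" .
qed

lemma slack_kernel_psd:
  assumes pack: "packing_graph X E"
  shows "slack_kernel a \<in> C_psd X E k"
proof -
  let ?Z = "triple_top X E k"
  have proj: "continuous_map ?Z (indep_top X E 1) (fst \<circ> fst)"
    "continuous_map ?Z (indep_top X E 1) (snd \<circ> fst)" "continuous_map ?Z (indep_top X E (k - 2)) snd"
    unfolding triple_top_def
    by (rule continuous_map_compose continuous_map_fst continuous_map_snd)+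
  note card_cont = proj[THEN continuous_map_compose, OF continuous_map_card[OF pack], unfolded o_def]
  have "continuous_map ?Z euclideanreal (slack_kernel a)"
    unfolding slack_kernel_def case_prod_unfold
    by (intro continuous_map_real_mult card_cont)
  moreover have "psd_kernel_on A (\<lambda>S T. slack_kernel a ((S, T), Q))" for A and Q :: "'a set"
    unfolding psd_kernel_on_def
  proof (intro conjI allI impI ballI)
    fix \<A> :: "'a set set" and c
    have "(\<Sum>S\<in>\<A>. \<Sum>T\<in>\<A>. c S * c T * slack_kernel a ((S, T), Q)) =
        newton_coeff a (card Q) * (\<Sum>S\<in>\<A>. c S * slack a (card S))\<^sup>2"
      by (simp add: slack_kernel_def power2_eq_square sum_product sum_distrib_left mult_ac)
    then show "0 \<le> (\<Sum>S\<in>\<A>. \<Sum>T\<in>\<A>. c S * c T * slack_kernel a ((S, T), Q))"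
      by (simp add: newton_coeff_nonneg)
  qed (simp add: slack_kernel_def mult_ac)
  ultimately show ?thesis
    by (auto simp: C_psd_def C_sym_triple_def C_space_def slack_kernel_def mult_ac)
qed

text \<open>Pairing the psd kernel \<open>slack_kernel a\<close> with the image of \<open>\<nu>\<close> under the adjoint of \<open>B_k\<close> gives a
  nonnegative number. Moving \<open>B_k\<close> to the other side turns this number into
  $a\,\nu(\{\emptyset\}) - \nu(\mathcal{I}_{=1})$.\<close>

lemma Delta_le_independence_bound:
  assumes G: "compact_packing_graph X E" and k: "a + 1 \<le> k" "2 \<le> k"
    and bound: "\<And>S. independent_set X E S \<Longrightarrow> finite S \<Longrightarrow> card S \<le> a"
  shows "Delta X E k \<le> ereal (real a)"
  unfolding Delta_def
proof (rule SUP_least)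
  fix \<nu> assume \<nu>: "\<nu> \<in> Delta_feasible X E k"
  let ?Y = "indep_top X E k" and ?B = "B_op k (slack_kernel a)"
  let ?E0 = "{I \<in> indep_sets X E k. card I = 0}" and ?E1 = "{I \<in> indep_sets X E k. card I = 1}"
  have pack: "packing_graph X E" using G by (simp add: compact_packing_graph_def)
  obtain \<mu> where \<mu>: "\<mu> \<in> M_psd X E k"
    "is_adjoint_image (triple_top X E k) ?Y (C_sym_triple X E k) (B_op k) \<nu> \<mu>"
    using \<nu> by (auto simp: Delta_feasible_def)
  obtain P N where PN: "radon_measure ?Y P" "radon_measure ?Y N"
    "\<nu> = (\<lambda>A. measure P A - measure N A)"
    using \<nu> by (auto simp: Delta_feasible_def M_nonneg_def M_space_def)
  have psd: "slack_kernel a \<in> C_psd X E k" by (rule slack_kernel_psd[OF pack])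
  then have "0 \<le> pairing (triple_top X E k) (slack_kernel a) \<mu>"
    using \<mu>(1) by (simp add: M_psd_def)
  also have "\<dots> = pairing ?Y ?B \<nu>"
    using \<mu>(2) psd by (simp add: is_adjoint_image_def C_psd_def)
  also have "\<dots> = (\<integral>I. ?B I \<partial>P) - (\<integral>I. ?B I \<partial>N)"
    unfolding PN(3) using psd
    by (intro pairing_eq indep_top_compact_t1[OF G] B_op_continuous[OF pack] PN)
      (simp add: C_psd_def C_sym_triple_def)
  finally have nonneg: "0 \<le> (\<integral>I. ?B I \<partial>P) - (\<integral>I. ?B I \<partial>N)" .
  have meas: "{I \<in> indep_sets X E k. card I = j} \<in> sets (borel_of ?Y)" for j
    using openin_indep_sets_card[OF pack, of k "\<lambda>n. n = j"] by (rule openin_in_borel_of)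
  have int: "(\<integral>I. ?B I \<partial>M) = real a * measure M ?E0 - measure M ?E1"
    if M: "radon_measure ?Y M" for M
  proof -
    have sets: "sets M = sets (borel_of ?Y)" and sp: "space M = indep_sets X E k"
      and "finite_measure M"
      using M sets_eq_imp_space_eq[of M "borel_of ?Y"] by (auto simp: radon_measure_def)
    interpret finite_measure M by fact
    have "?B I = real a * indicator ?E0 I - indicator ?E1 I" if "I \<in> space M" for I
    proof -
      have I: "I \<in> indep_sets X E k" using that sp by simp
      then have "finite I" "card I \<le> a"
        using bound[of I] by (auto simp: indep_sets_def Sub_def)
      then have B: "?B I = (if card I \<le> 1 then slack a (card I) else 0)"
        by (rule B_op_slack_kernel[OF _ _ k])
      consider "card I = 0" | "card I = 1" | "1 < card I" by linarith
      then show ?thesis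
        unfolding B by cases (use I in \<open>simp_all add: slack_def indicator_def\<close>)
    qed
    then have "(\<integral>I. ?B I \<partial>M) = (\<integral>I. real a * indicator ?E0 I - indicator ?E1 I \<partial>M)"
      by (intro Bochner_Integration.integral_cong refl)
    also have "\<dots> = real a * measure M ?E0 - measure M ?E1"
    proof -
      have E01: "?E0 \<in> sets M" "?E1 \<in> sets M" using meas sets by auto
      have i: "integrable M (indicator A :: _ \<Rightarrow> real)" if "A \<in> sets M" for A
        using that by (simp add: less_top[symmetric])
      show ?thesis
        using i[OF E01(1)] i[OF E01(2)] sets.sets_into_space[OF E01(1)] sets.sets_into_space[OF E01(2)]
        by (subst Bochner_Integration.integral_diff) (auto simp: Int_absorb2)
    qed
    finally show ?thesis .
  qed
  have "?E0 = {{}}" by (auto simp: indep_sets_def Sub_def independent_set_def)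
  moreover have "?E1 = indep_sets_eq X E 1"
    using k by (auto simp: indep_sets_eq_def indep_sets_def Sub_def)
  moreover have "\<nu> {{}} = 1" using \<nu> by (simp add: Delta_feasible_def)
  moreover have "0 \<le> real a * \<nu> ?E0 - \<nu> ?E1"
    using nonneg unfolding int[OF PN(1)] int[OF PN(2)] PN(3) by (simp add: algebra_simps)
  ultimately show "ereal (\<nu> (indep_sets_eq X E 1)) \<le> ereal (real a)" by simp
qed

section \<open>Lower bounds for the copositive hierarchy\<close>

text \<open>Put mass \<open>w j\<close> at tuples \<open>x j\<close> of vertices in an independent set. The adjoint of
  $\mathcal{T}_r$ spreads each atom over its ordered pairs of distinct positions. None of these pairs is an
  edge, the total mass is kept, and the mass of the diagonal is the weighted frequency with which two
  positions coincide. So any such family with the right frequency is feasible.\<close>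

lemma sum_coincidences_le_xi:
  fixes w :: "'j \<Rightarrow> real" and x :: "'j \<Rightarrow> nat \<Rightarrow> 'a"
  assumes G: "compact_packing_graph X E" and W: "independent_set X E W"
    and J: "finite J" "\<And>j. j \<in> J \<Longrightarrow> 0 \<le> w j" "\<And>j. j \<in> J \<Longrightarrow> x j \<in> PiE {..<r + 2} (\<lambda>_. W)"
    and coincidences: "(\<Sum>j\<in>J. \<Sum>\<pi> | \<pi> permutes {..<r + 2}. w j * of_bool (x j (\<pi> 0) = x j (\<pi> 1)))
      = fact (r + 2)"
  shows "ereal (\<Sum>j\<in>J. w j) \<le> xi X E r"
proof -
  let ?n = "r + 2"
  let ?P = "{\<pi>. \<pi> permutes {..<?n}}"
  let ?XX = "prod_topology X X" and ?Y = "power_top X ?n"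
  let ?D = "{(x, x) |x. x \<in> topspace X}"
  let ?w = "\<lambda>(j, \<pi>). w j / fact ?n" and ?p = "\<lambda>(j, \<pi>). (x j (\<pi> 0), x j (\<pi> 1))"
  have Haus: "Hausdorff_space X" and irr: "irrefl E" and comp: "compact_space X"
    using G by (auto simp: compact_packing_graph_def packing_graph_def topological_graph_def)
  have finP: "finite ?P" by (simp add: finite_permutations)
  have cardP: "card ?P = fact ?n" by (rule card_permutations) auto
  have WX: "W \<subseteq> topspace X" using W by (simp add: independent_set_def)
  have xW: "x j (\<pi> i) \<in> W" if "j \<in> J" "\<pi> permutes {..<?n}" "i < ?n" for j \<pi> i
    using J(3)[OF that(1)] permutes_in_image[OF that(2), of i] that(3) by (auto simp: PiE_iff)
  interpret \<beta>: finite_atoms ?Y J w x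
    using J WX by unfold_locales (auto simp: power_top_def PiE_iff subset_iff)
  interpret \<mu>: finite_atoms ?XX "J \<times> ?P" ?w ?p
    using J finP xW WX by unfold_locales (auto simp: subset_iff)
  let ?\<beta> = "measure \<beta>.\<rho>" and ?\<mu> = "measure \<mu>.\<rho>"
  have t1: "t1_space X" using Haus by (rule Hausdorff_imp_t1_space)
  have t1Y: "t1_space ?Y" "compact_space ?Y" and t1XX: "t1_space ?XX" "compact_space ?XX"
    using t1 comp by (simp_all add: power_top_def t1_space_product_topology t1_space_prod_topology
        compact_space_product_topology compact_space_prod_topology)
  have cont_pair: "continuous_map ?Y ?XX (\<lambda>v. (v (\<pi> 0), v (\<pi> 1)))"
    if "\<pi> permutes {..<?n}" for \<pi>
    unfolding power_top_def
    using permutes_in_image[OF that, of 0] permutes_in_image[OF that, of 1]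
    by (intro continuous_map_pairedI continuous_map_product_projection) auto
  have T_cont: "T_op r F \<in> C_space ?Y" if "F \<in> C_space ?XX" for F
  proof -
    have "continuous_map ?Y euclideanreal (\<lambda>v. F (v (\<pi> 0), v (\<pi> 1)))" if "\<pi> \<in> ?P" for \<pi>
      using continuous_map_compose[OF cont_pair, of \<pi> euclideanreal F] that \<open>F \<in> C_space ?XX\<close>
      by (simp add: o_def C_space_def)
    then have "continuous_map ?Y euclideanreal
        (\<lambda>v. 1 / fact ?n * (\<Sum>\<pi>\<in>?P. F (v (\<pi> 0), v (\<pi> 1))))"
      by (intro continuous_map_real_mult continuous_map_sum finP) auto
    then show ?thesis by (simp add: C_space_def T_op_def[abs_def])
  qed
  have adj: "is_adjoint_image ?XX ?Y (C_space ?XX) (T_op r) ?\<beta> ?\<mu>"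
    unfolding is_adjoint_image_def
  proof
    fix F assume F: "F \<in> C_space ?XX"
    have "pairing ?XX F ?\<mu> = (\<Sum>j\<in>J. \<Sum>\<pi>\<in>?P. w j / fact ?n * F (x j (\<pi> 0), x j (\<pi> 1)))"
      using \<mu>.pairing_atomic[OF t1XX F] by (simp add: sum.cartesian_product case_prod_unfold)
    also have "\<dots> = (\<Sum>j\<in>J. w j * T_op r F (x j))"
      by (simp add: T_op_def sum_distrib_left sum_divide_distrib)
    also have "\<dots> = pairing ?Y (T_op r F) ?\<beta>"
      using \<beta>.pairing_atomic[OF t1Y T_cont[OF F]] by simp
    finally show "pairing ?XX F ?\<mu> = pairing ?Y (T_op r F) ?\<beta>" .
  qed
  \<comment> \<open>Swapping the coordinates of the pair is precomposing \<open>\<pi>\<close> with the transposition of 0 and 1.\<close>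
  have "invariant_under ?XX prod.swap ?\<mu>"
  proof (rule \<mu>.atomic_invariant[where \<tau> = "\<lambda>(j, \<pi>). (j, \<pi> \<circ> Transposition.transpose 0 1)"])
    show "continuous_map ?XX ?XX prod.swap"
      by (simp add: continuous_map_pairwise o_def continuous_map_fst continuous_map_snd)
    have t: "Transposition.transpose 0 1 permutes {..<?n}" by (rule permutes_swap_id) auto
    show "bij_betw (\<lambda>(j, \<pi>). (j, \<pi> \<circ> Transposition.transpose 0 1)) (J \<times> ?P) (J \<times> ?P)"
      by (rule bij_betwI[where g = "\<lambda>(j, \<pi>). (j, \<pi> \<circ> Transposition.transpose 0 1)"])
        (use permutes_compose[OF t] in \<open>auto simp: o_assoc[symmetric]\<close>)
  qed auto
  then have sym: "?\<mu> \<in> M_sym_nonneg X"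
    using \<mu>.atomic_in_M_nonneg[OF t1XX(1)] by (simp add: M_sym_nonneg_def M_sym_def M_nonneg_def)
  have "closedin ?XX ((\<lambda>x. (x, x)) ` topspace X)"
    using Haus by (simp add: Hausdorff_space_closedin_diagonal)
  moreover have "(\<lambda>x. (x, x)) ` topspace X = ?D" by auto
  ultimately have D: "?D \<in> sets (borel_of ?XX)" by (simp add: closedin_in_borel_of)
  have "?\<mu> ?D = (\<Sum>j\<in>J. \<Sum>\<pi>\<in>?P. w j / fact ?n * indicator ?D (x j (\<pi> 0), x j (\<pi> 1)))"
    unfolding \<mu>.measure_atomic[OF D] by (simp only: sum.cartesian_product case_prod_unfold)
  also have "\<dots> = (\<Sum>j\<in>J. \<Sum>\<pi>\<in>?P. w j * of_bool (x j (\<pi> 0) = x j (\<pi> 1))) / fact ?n"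
    unfolding sum_divide_distrib
    using xW WX by (intro sum.cong refl) (auto simp: indicator_def subset_iff)
  finally have diag: "?\<mu> ?D = 1" using coincidences by simp
  \<comment> \<open>If \<open>A \<inter> E\<close> is not Borel, the value is 0 by the convention on \<^const>\<open>measure\<close>.\<close>
  have edges: "?\<mu> (A \<inter> E) = 0" for A
  proof (cases "A \<inter> E \<in> sets (borel_of ?XX)")
    case True
    have "?p i \<notin> E" if mem: "i \<in> J \<times> ?P" for i
    proof -
      obtain j \<pi> where i: "i = (j, \<pi>)" "j \<in> J" "\<pi> permutes {..<?n}" using mem by auto
      have "x j (\<pi> 0) \<in> W" "x j (\<pi> 1) \<in> W" using xW[OF i(2,3)] by auto
      then show ?thesis
        using W irr i(1) by (cases "x j (\<pi> 0) = x j (\<pi> 1)")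
          (auto simp: independent_set_def pairwise_def irrefl_def)
    qed
    then show ?thesis unfolding \<mu>.measure_atomic[OF True] by (intro sum.neutral ballI) simp
  next
    case False
    then have "A \<inter> E \<notin> sets \<mu>.\<rho>" by (simp only: \<mu>.sets_atomic not_False_eq_True)
    then show ?thesis by (rule measure_notin_sets)
  qed
  have XX: "topspace X \<times> topspace X \<in> sets (borel_of ?XX)"
    using openin_in_borel_of[OF openin_topspace[of ?XX]] by simp
  have "?\<mu> (topspace X \<times> topspace X) =
      (\<Sum>j\<in>J. \<Sum>\<pi>\<in>?P. w j / fact ?n * indicator (topspace X \<times> topspace X) (x j (\<pi> 0), x j (\<pi> 1)))"
    unfolding \<mu>.measure_atomic[OF XX] by (simp only: sum.cartesian_product case_prod_unfold)
  also have "\<dots> = (\<Sum>j\<in>J. \<Sum>\<pi>\<in>?P. w j / fact ?n)"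
    using xW WX by (intro sum.cong refl) (auto simp: indicator_def subset_iff)
  also have "\<dots> = (\<Sum>j\<in>J. w j)"
    by (simp only: sum_constant cardP of_nat_fact times_divide_eq_right
        nonzero_mult_div_cancel_left[OF fact_nonzero])
  finally have total: "?\<mu> (topspace X \<times> topspace X) = (\<Sum>j\<in>J. w j)" .
  have "(?\<mu>, ?\<beta>) \<in> xi_feasible X E r"
    using sym \<beta>.atomic_in_M_nonneg[OF t1Y(1)] adj diag edges by (simp add: xi_feasible_def)
  then have "ereal (?\<mu> (topspace X \<times> topspace X)) \<le> xi X E r"
    unfolding xi_def by (rule SUP_upper2) simp
  then show ?thesis unfolding total .
qed

text \<open>The entry at \<open>b\<close> is determined by the entry at \<open>a\<close>; the other entries are free.\<close>

lemma card_PiE_coincidence: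
  assumes "finite W" "a < n" "b < n" "a \<noteq> b"
  shows "card {x \<in> PiE {..<n} (\<lambda>_. W). x a = x b} = card W ^ (n - 1)"
proof -
  have "bij_betw (\<lambda>x. restrict x ({..<n} - {b})) {x \<in> PiE {..<n} (\<lambda>_. W). x a = x b}
      (PiE ({..<n} - {b}) (\<lambda>_. W))"
  proof (rule bij_betw_byWitness[where f' = "\<lambda>y. y(b := y a)"])
    show "\<forall>x\<in>{x \<in> PiE {..<n} (\<lambda>_. W). x a = x b}. (restrict x ({..<n} - {b}))(b := restrict x ({..<n} - {b}) a) = x"
      using assms by (auto simp: fun_eq_iff PiE_iff extensional_def)
    show "\<forall>y\<in>PiE ({..<n} - {b}) (\<lambda>_. W). restrict (y(b := y a)) ({..<n} - {b}) = y"
      by (auto simp: fun_eq_iff PiE_iff extensional_def)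
    show "(\<lambda>x. restrict x ({..<n} - {b})) ` {x \<in> PiE {..<n} (\<lambda>_. W). x a = x b} \<subseteq> PiE ({..<n} - {b}) (\<lambda>_. W)"
      by (rule image_subsetI) (simp add: PiE_iff)
    show "(\<lambda>y. y(b := y a)) ` PiE ({..<n} - {b}) (\<lambda>_. W) \<subseteq> {x \<in> PiE {..<n} (\<lambda>_. W). x a = x b}"
      using assms by (intro image_subsetI) (simp add: PiE_iff extensional_def)
  qed
  then show ?thesis using assms by (simp add: bij_betw_same_card card_PiE)
qed

text \<open>For a uniformly random tuple of vertices in \<open>W\<close>, two positions coincide with probability
  $1/|W|$. So the uniform distribution scaled to total mass $|W|$ is feasible.\<close>

lemma card_independent_le_xi:
  assumes G: "compact_packing_graph X E" and W: "independent_set X E W" "finite W" "W \<noteq> {}"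
  shows "ereal (real (card W)) \<le> xi X E r"
proof -
  let ?n = "r + 2"
  let ?J = "PiE {..<?n} (\<lambda>_. W)" and ?P = "{\<pi>. \<pi> permutes {..<?n}}"
  have cardP: "card ?P = fact ?n" by (rule card_permutations) auto
  \<comment> \<open>total mass $|W|$, shared equally by the $|W|^{r+2}$ tuples\<close>
  define c where "c = 1 / real (card W) ^ (r + 1)"
  have pos: "0 < real (card W)" using W by (simp add: card_gt_0_iff)
  have "(\<Sum>j\<in>?J. \<Sum>\<pi>\<in>?P. c * of_bool (j (\<pi> 0) = j (\<pi> 1))) =
      (\<Sum>\<pi>\<in>?P. \<Sum>j\<in>?J. c * of_bool (j (\<pi> 0) = j (\<pi> 1)))"
    by (rule sum.swap)
  also have "\<dots> = (\<Sum>\<pi>\<in>?P. 1)"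
  proof (rule sum.cong[OF refl])
    fix \<pi> assume "\<pi> \<in> ?P"
    then have \<pi>: "\<pi> permutes {..<?n}" by simp
    have "\<pi> 0 < ?n" "\<pi> 1 < ?n" "\<pi> 0 \<noteq> \<pi> 1"
      using permutes_in_image[OF \<pi>, of 0] permutes_in_image[OF \<pi>, of 1]
        inj_eq[OF permutes_inj[OF \<pi>], of 0 1] by auto
    from card_PiE_coincidence[OF W(2) this]
    have "real (card (?J \<inter> {j. j (\<pi> 0) = j (\<pi> 1)})) = real (card W) ^ (r + 1)"
      by (simp add: Int_def)
    moreover have "finite ?J" using W by (simp add: finite_PiE)
    ultimately have "(\<Sum>j\<in>?J. of_bool (j (\<pi> 0) = j (\<pi> 1))) = real (card W) ^ (r + 1)"
      by (simp only: sum_of_bool_eq)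
    then show "(\<Sum>j\<in>?J. c * of_bool (j (\<pi> 0) = j (\<pi> 1))) = 1"
      unfolding sum_distrib_left[symmetric] c_def using pos by simp
  qed
  also have "\<dots> = fact ?n"
    by (simp only: sum_constant cardP of_nat_fact mult_1_right)
  finally have "ereal (\<Sum>j\<in>?J. c) \<le> xi X E r"
    using W pos by (intro sum_coincidences_le_xi[OF G W(1), where x = "\<lambda>j. j"])
      (auto simp: finite_PiE c_def)
  moreover have "(\<Sum>j\<in>?J. c) = real (card W)"
    using pos by (simp add: c_def card_PiE)
  ultimately show ?thesis by simp
qed

text \<open>A tuple without repetitions contributes nothing to the diagonal, so it can receive any mass. One
  constant tuple of mass 1 supplies the required mass of the diagonal.\<close>

lemma xi_infinite:
  assumes G: "compact_packing_graph X E" and W: "independent_set X E W" "finite W" "r + 2 \<le> card W"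
  shows "xi X E r = \<infinity>"
proof (rule ereal_top)
  fix B :: real
  let ?n = "r + 2" and ?P = "{\<pi>. \<pi> permutes {..<r + 2}}"
  have cardP: "card ?P = fact ?n" by (rule card_permutations) auto
  obtain h where h: "h ` {..<?n} \<subseteq> W" "inj_on h {..<?n}"
    using card_le_inj[of "{..<?n}" W] W by auto
  \<comment> \<open>\<open>True\<close> indexes the constant tuple, \<open>False\<close> the tuple without repetitions\<close>
  define w where "w b = (if b then 1 else \<bar>B\<bar>)" for b
  define x where "x b = (\<lambda>i\<in>{..<?n}. if b then h 0 else h i)" for b
  have "w b * of_bool (x b (\<pi> 0) = x b (\<pi> 1)) = of_bool b" if "\<pi> \<in> ?P" for b \<pi>
  proof -
    have \<pi>: "\<pi> permutes {..<?n}" using that by simp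
    have "\<pi> 0 < ?n" "\<pi> 1 < ?n" "\<pi> 0 \<noteq> \<pi> 1"
      using permutes_in_image[OF \<pi>, of 0] permutes_in_image[OF \<pi>, of 1]
        inj_eq[OF permutes_inj[OF \<pi>], of 0 1] by auto
    then show ?thesis
      using inj_onD[OF h(2), of "\<pi> 0" "\<pi> 1"] by (auto simp: w_def x_def)
  qed
  then have "(\<Sum>b\<in>UNIV. \<Sum>\<pi>\<in>?P. w b * of_bool (x b (\<pi> 0) = x b (\<pi> 1))) =
      (\<Sum>b\<in>UNIV. \<Sum>\<pi>\<in>?P. of_bool b)"
    by (intro sum.cong refl) auto
  also have "\<dots> = fact ?n"
    by (simp only: sum_constant cardP of_nat_fact) (simp add: UNIV_bool)
  finally have "ereal (\<Sum>b\<in>UNIV. w b) \<le> xi X E r"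
    using h(1) by (intro sum_coincidences_le_xi[OF G W(1), where x = x])
      (auto simp: w_def x_def)
  moreover have "B \<le> (\<Sum>b\<in>UNIV. w b)" by (simp add: UNIV_bool w_def)
  ultimately show "ereal B \<le> xi X E r" by (meson ereal_less_eq(3) order_trans)
qed

section \<open>Comparison of the two hierarchies\<close>

lemma Sup_enat_in:
  fixes A :: "enat set"
  assumes "A \<noteq> {}" "Sup A < \<infinity>"
  shows "Sup A \<in> A"
  using assms Max_in[of A] by (simp add: Sup_enat_def split: if_splits)

lemma maximum_independent_set:
  assumes "compact_packing_graph X E"
  obtains W where "independent_set X E W" "finite W" "independence_number X E = enat (card W)"
    "\<And>S. independent_set X E S \<Longrightarrow> finite S \<Longrightarrow> card S \<le> card W"
proof -
  let ?f = "\<lambda>S. if finite S then enat (card S) else \<infinity>"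
  let ?A = "?f ` {S. independent_set X E S}"
  have lt: "Sup ?A < \<infinity>"
    using independence_number_finite[OF assms] by (simp add: independence_number_def)
  have "independent_set X E {}" by (simp add: independent_set_def)
  then have ne: "?A \<noteq> {}" by blast
  have "Sup ?A \<in> ?A" by (rule Sup_enat_in[OF ne lt])
  then obtain W where W: "independent_set X E W" "Sup ?A = ?f W" by auto
  then have fin: "finite W" using lt by (auto split: if_splits)
  moreover have "card S \<le> card W" if "independent_set X E S" "finite S" for S
  proof -
    have "?f S \<le> Sup ?A" by (rule Sup_upper) (use that in blast)
    then show ?thesis using W(2) fin that by simp
  qed
  moreover have "independence_number X E = enat (card W)"
    using W(2) fin by (simp add: independence_number_def)
  ultimately show ?thesis using that W(1) by blast
qed

theorem theorem4p2:
  fixes X :: "'a topology" and E :: "('a \<times> 'a) set"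
  assumes "compact_packing_graph X E" and "topspace X \<noteq> {}"
  shows "(\<forall>r\<ge>1. Delta X E (r + 2) \<le> xi X E r) \<and>
         (\<forall>k. independence_number X E + 2 \<le> enat k \<longrightarrow>
              Delta X E k = ereal_of_enat (independence_number X E))"
proof -
  obtain W where W: "independent_set X E W" "finite W" "independence_number X E = enat (card W)"
    "\<And>S. independent_set X E S \<Longrightarrow> finite S \<Longrightarrow> card S \<le> card W"
    using maximum_independent_set[OF assms(1)] by blast
  obtain v where "v \<in> topspace X" using assms(2) by blast
  then have "independent_set X E {v}" by (simp add: independent_set_def)
  then have "W \<noteq> {}" using W(4)[of "{v}"] by auto
  have "Delta X E (r + 2) \<le> xi X E r" for r
  proof (cases "r + 2 \<le> card W")
    case True
    then show ?thesis using xi_infinite[OF assms(1) W(1,2)] by simp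
  next
    case False
    then have "Delta X E (r + 2) \<le> ereal (real (card W))"
      using W(4) by (intro Delta_le_independence_bound[OF assms(1)]) auto
    also have "\<dots> \<le> xi X E r"
      by (rule card_independent_le_xi[OF assms(1) W(1,2) \<open>W \<noteq> {}\<close>])
    finally show ?thesis .
  qed
  moreover have "Delta X E k = ereal_of_enat (independence_number X E)"
    if "independence_number X E + 2 \<le> enat k" for k
  proof -
    have k: "card W + 2 \<le> k"
      using that by (simp add: W(3) numeral_eq_enat)
    have "Delta X E k \<le> ereal (real (card W))"
      using W(4) k by (intro Delta_le_independence_bound[OF assms(1)]) auto
    moreover have "ereal (real (card W)) \<le> Delta X E k"
      using k by (intro Delta_ge_card_independent[OF assms(1) W(1,2)]) auto
    ultimately show ?thesis by (simp add: W(3))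
  qed
  ultimately show ?thesis by blast
qed

end
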